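(* Let $N\ge 2$ and $j\ge 2$ be integers, let $p=(p_1,\dots,p_N)$ be a probability vector with $p_i>0$ for all $i$ and $p\ne u$, where $u=(1/N,\dots,1/N)$. Then: (1) For every real $z>1$, the map $\theta\mapsto \mathbb E_{u+\theta(p-u)}\,z^{U_j^N}$ is strictly decreasing on $(0,1]$. In particular, $\mathbb E_p z^{U_j^N}<\mathbb E_u z^{U_j^N}$ for every $z>1$. (2) For every integer $1\le m\le N$, the map $\theta\mapsto \mathbb E_{u+\theta(p-u)}\binom{U_j^N}{m}$ is strictly decreasing on $(0,1]$. In particular, $\mathbb E_p\binom{U_j^N}{m}\le \mathbb E_u\binom{U_j^N}{m}$ for every integer $m\ge 1$; this inequality is strict for $1\le m\le N$, and for $m>N$ both sides are zero.
   Context: Siblings coupon-collector model: for a probability vector $p=(p_1,\dots,p_N)$ with all $p_i>0$, coupons with types in $\{1,\dots,N\}$ are sampled independently with replacement, each having type $i$ with probability $p_i$. The main collector stops at the first time $\tau$ at which all $N$ types have appeared at least once (almost surely finite). Duplicates are passed to the next collector (sibling); if that collector already has that type, the coupon is passed to the next sibling, and so on. $U_j^N$ is the number of empty spaces in the $j$th collector's album at time $\tau$ (the main collector being the first collector); equivalently, $U_j^N$ is the number of coupon types whose total count among the first $\tau$ coupons is less than $j$. $\mathbb E_p$ denotes expectation when the coupon-type law is $p$. *)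

theory Defs
  imports "HOL-Probability.Probability"
begin

definition is_prob_vector :: "nat \<Rightarrow> (nat \<Rightarrow> real) \<Rightarrow> bool" where
  "is_prob_vector N q \<longleftrightarrow> (\<forall>i\<in>{1..N}. 0 \<le> q i) \<and> (\<Sum>i=1..N. q i) = 1"

definition uniform_vector :: "nat \<Rightarrow> nat \<Rightarrow> real" where
  "uniform_vector N = (\<lambda>i. 1 / real N)"

definition segment_vector :: "nat \<Rightarrow> (nat \<Rightarrow> real) \<Rightarrow> real \<Rightarrow> nat \<Rightarrow> real" where
  "segment_vector N p \<theta> = (\<lambda>i. uniform_vector N i + \<theta> * (p i - uniform_vector N i))"

text \<open>
  Vectors indexed by \<open>{1..N}\<close> are functions on \<^typ>\<open>nat\<close> whose values outside \<open>{1..N}\<close> are ignored.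
  \<open>embed_pmf\<close> is only meaningful if \<open>q\<close> is a probability vector on \<open>{1..N}\<close>.
\<close>

definition coupon_pmf :: "nat \<Rightarrow> (nat \<Rightarrow> real) \<Rightarrow> nat pmf" where
  "coupon_pmf N q = embed_pmf (\<lambda>i. if i \<in> {1..N} then q i else 0)"

text \<open>A sample point \<open>\<omega>\<close> is the sequence of coupon types drawn, \<open>\<omega> n\<close> being the type of the
  coupon number \<open>n + 1\<close>.\<close>

definition coupon_space :: "nat \<Rightarrow> (nat \<Rightarrow> real) \<Rightarrow> (nat \<Rightarrow> nat) measure" where
  "coupon_space N q = (\<Pi>\<^sub>M n\<in>UNIV. measure_pmf (coupon_pmf N q))"

text \<open>On the event that some type never appears, \<open>LEAST\<close> returns an unspecified number;
  \<open>AE_all_types_appear\<close> below shows that this event is null if all \<open>q i\<close> are positive.\<close>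

definition completion_time :: "nat \<Rightarrow> (nat \<Rightarrow> nat) \<Rightarrow> nat" where
  "completion_time N \<omega> = (LEAST n. \<forall>i\<in>{1..N}. \<exists>k<n. \<omega> k = i)"

text \<open>\<open>albums \<omega> n j\<close> is the set of types in the album of collector \<open>j\<close> after \<open>n\<close> coupons.
  Collectors are numbered from \<open>1\<close> (the main collector); each coupon goes to the first
  collector who does not have its type yet.\<close>

primrec albums :: "(nat \<Rightarrow> nat) \<Rightarrow> nat \<Rightarrow> nat \<Rightarrow> nat set" where
  "albums \<omega> 0 = (\<lambda>j. {})"
| "albums \<omega> (Suc n) =
    (let A = albums \<omega> n; r = (LEAST k. 1 \<le> k \<and> \<omega> n \<notin> A k)
     in A(r := insert (\<omega> n) (A r)))"

definition empty_spaces :: "nat \<Rightarrow> nat \<Rightarrow> (nat \<Rightarrow> nat) \<Rightarrow> nat" where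
  "empty_spaces N j \<omega> = card ({1..N} - albums \<omega> (completion_time N \<omega>) j)"

definition coupon_expectation ::
    "nat \<Rightarrow> (nat \<Rightarrow> real) \<Rightarrow> ((nat \<Rightarrow> nat) \<Rightarrow> real) \<Rightarrow> real" where
  "coupon_expectation N q X = (\<integral>\<omega>. X \<omega> \<partial>coupon_space N q)"

lemma pmf_coupon_pmf:
  assumes "is_prob_vector N q"
  shows "pmf (coupon_pmf N q) i = (if i \<in> {1..N} then q i else 0)"
  unfolding coupon_pmf_def
proof (rule pmf_embed_pmf)
  show "0 \<le> (if i \<in> {1..N} then q i else 0)" for i
    using assms by (auto simp: is_prob_vector_def)
  have "(\<integral>\<^sup>+i. ennreal (if i \<in> {1..N} then q i else 0) \<partial>count_space UNIV)
      = (\<Sum>i\<in>{1..N}. ennreal (if i \<in> {1..N} then q i else 0))"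
    by (rule nn_integral_count_space') auto
  also have "\<dots> = ennreal (\<Sum>i\<in>{1..N}. q i)"
    using assms by (subst sum_ennreal[symmetric]) (auto simp: is_prob_vector_def)
  finally show "(\<integral>\<^sup>+i. ennreal (if i \<in> {1..N} then q i else 0) \<partial>count_space UNIV) = 1"
    using assms by (simp add: is_prob_vector_def)
qed

lemma prob_space_coupon_space: "prob_space (coupon_space N q)"
  unfolding coupon_space_def by (intro prob_space_PiM measure_pmf.prob_space_axioms)

lemma is_prob_vector_segment:
  assumes "is_prob_vector N p" "N \<ge> 1" "\<theta> \<in> {0..1}"
  shows "is_prob_vector N (segment_vector N p \<theta>)"
proof -
  have "segment_vector N p \<theta> i = (1 - \<theta>) * uniform_vector N i + \<theta> * p i" for i
    by (simp add: segment_vector_def algebra_simps)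
  then show ?thesis
    using assms
    by (auto simp: is_prob_vector_def uniform_vector_def sum.distrib simp flip: sum_distrib_left)
qed

lemma mem_albums_iff:
  "i \<in> albums \<omega> n j \<longleftrightarrow> 0 < j \<and> j \<le> card {k. k < n \<and> \<omega> k = i}"
proof (induction n arbitrary: i j)
  case 0
  then show ?case by auto
next
  case (Suc n)
  define c where "c = (\<lambda>i. card {k. k < n \<and> \<omega> k = i})"
  have c_Suc: "card {k. k < Suc n \<and> \<omega> k = i} = (if \<omega> n = i then Suc (c i) else c i)" for i
  proof -
    have "{k. k < Suc n \<and> \<omega> k = i} =
      (if \<omega> n = i then insert n {k. k < n \<and> \<omega> k = i} else {k. k < n \<and> \<omega> k = i})"
      by (auto simp: less_Suc_eq)
    then show ?thesis by (simp add: c_def)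
  qed
  have IH: "i \<in> albums \<omega> n j \<longleftrightarrow> j \<noteq> 0 \<and> j \<le> c i" for i j
    using Suc.IH by (simp add: c_def)
  have r: "(LEAST k. 1 \<le> k \<and> \<omega> n \<notin> albums \<omega> n k) = Suc (c (\<omega> n))"
    by (rule Least_equality) (auto simp: IH)
  show ?case
    unfolding albums.simps Let_def r c_Suc by (auto simp: IH)
qed

lemma empty_spaces_eq_card_count_less:
  assumes "j \<ge> 1"
  shows "empty_spaces N j \<omega> =
    card {i \<in> {1..N}. card {k. k < completion_time N \<omega> \<and> \<omega> k = i} < j}"
  unfolding empty_spaces_def
  using assms by (intro arg_cong[of _ _ card]) (auto simp: mem_albums_iff)

lemma AE_all_types_appear:
  assumes q: "is_prob_vector N q" and pos: "\<forall>i\<in>{1..N}. 0 < q i"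
  shows "AE \<omega> in coupon_space N q. \<exists>n. \<forall>i\<in>{1..N}. \<exists>k<n. \<omega> k = i"
proof -
  interpret P: product_prob_space "\<lambda>_::nat. measure_pmf (coupon_pmf N q)" UNIV
    by unfold_locales
  let ?M = "coupon_space N q"
  interpret M: prob_space ?M by (rule prob_space_coupon_space)
  have one: "AE \<omega> in ?M. \<exists>k. \<omega> k = i" if i: "i \<in> {1..N}" for i
  proof -
    define B where "B = (\<lambda>n::nat. {\<omega> \<in> space ?M. \<forall>k<n. \<omega> k \<noteq> i})"
    have Bn: "B n \<in> sets ?M \<and> measure ?M (B n) = (1 - q i) ^ n" for n
    proof -
      have eq: "B n = {\<omega> \<in> space ?M. \<forall>k\<in>{..<n}. \<omega> k \<in> - {i}}"
        by (auto simp: B_def)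
      have "emeasure ?M {\<omega> \<in> space ?M. \<forall>k\<in>{..<n}. \<omega> k \<in> - {i}}
          = (\<Prod>k<n. emeasure (measure_pmf (coupon_pmf N q)) (- {i}))"
        unfolding coupon_space_def by (rule P.emeasure_PiM_Collect) auto
      then have "measure ?M {\<omega> \<in> space ?M. \<forall>k\<in>{..<n}. \<omega> k \<in> - {i}}
          = measure (measure_pmf (coupon_pmf N q)) (- {i}) ^ n"
        by (simp add: M.emeasure_eq_measure measure_pmf.emeasure_eq_measure ennreal_power)
      moreover have "measure (measure_pmf (coupon_pmf N q)) (- {i}) = 1 - q i"
        using measure_pmf.prob_compl[of "{i}" "coupon_pmf N q"] i
        by (simp add: Compl_eq_Diff_UNIV measure_pmf_single pmf_coupon_pmf[OF q])
      moreover have "B n \<in> sets ?M"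
        unfolding B_def coupon_space_def by measurable
      ultimately show ?thesis by (simp add: eq)
    qed
    have "q i \<le> 1"
      using pmf_le_1[of "coupon_pmf N q" i] i by (simp add: pmf_coupon_pmf[OF q])
    then have "(\<lambda>n. (1 - q i) ^ n) \<longlonglongrightarrow> 0"
      using pos i by (intro LIMSEQ_realpow_zero) auto
    moreover have sets: "range B \<subseteq> sets ?M"
      using Bn by blast
    moreover have "decseq B"
      unfolding decseq_def B_def by (blast intro: less_le_trans)
    ultimately have "measure ?M (\<Inter>n. B n) = 0"
      using M.finite_Lim_measure_decseq[of B] LIMSEQ_unique
      unfolding Bn[THEN conjunct2] by blast
    moreover have "(\<Inter>n. B n) \<in> sets ?M"
      using sets by (intro sets.countable_INT) auto
    ultimately have "(\<Inter>n. B n) \<in> null_sets ?M"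
      by (intro null_setsI) (simp_all add: M.emeasure_eq_measure)
    moreover have "{\<omega> \<in> space ?M. \<not> (\<exists>k. \<omega> k = i)} \<subseteq> (\<Inter>n. B n)"
      unfolding B_def by blast
    ultimately show ?thesis
      by (rule AE_I')
  qed
  have "AE \<omega> in ?M. \<forall>i\<in>{1..N}. \<exists>k. \<omega> k = i"
    by (rule AE_finite_allI[OF finite_atLeastAtMost]) (rule one)
  then show ?thesis
  proof (rule AE_mp, intro AE_I2 impI)
    fix \<omega> :: "nat \<Rightarrow> nat"
    assume "\<forall>i\<in>{1..N}. \<exists>k. \<omega> k = i"
    then obtain f where f: "\<forall>i\<in>{1..N}. \<omega> (f i) = i" by metis
    have "f i < Suc (\<Sum>i\<in>{1..N}. f i)" if "i \<in> {1..N}" for i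
      using member_le_sum[of i "{1..N}" f] that by (simp add: less_Suc_eq_le)
    with f show "\<exists>n. \<forall>i\<in>{1..N}. \<exists>k<n. \<omega> k = i"
      by (intro exI[of _ "Suc (\<Sum>i\<in>{1..N}. f i)"]) blast
  qed
qed

end

theory Submission
  imports Defs
begin

text \<open>
  Let the coupons arrive at the times of a Poisson process of rate \<open>1\<close>. The types then arrive as
  independent Poisson processes with rates \<open>q i\<close>, and the expectation of
  \<open>empty_spaces choose m\<close>, which counts the sets \<open>S\<close> of \<open>m\<close> types that occur fewer than \<open>j\<close>
  times, becomes an integral over the completion time \<open>t\<close>: the sum over \<open>S\<close> and over the
  completing type \<open>i\<close> of \<open>q i * exp (- (q i * t)) * (\<Prod>k \<noteq> i. w k (q k * t))\<close>. Here \<open>w k x\<close> is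
  the probability that a Poisson variable with mean \<open>x\<close> lies in \<open>{1..<j}\<close> if \<open>k \<in> S\<close>, and that
  it is positive otherwise (\<open>nn_integral_binomial_empty_spaces\<close>).

  Let \<open>q = u + \<theta> * d\<close> with \<open>d = p - u\<close> move along the segment. The derivative of the integrand
  with respect to \<open>\<theta>\<close> is the time derivative of a quantity that vanishes at time \<open>0\<close> and at
  infinity, plus a source term (\<open>DERIV_deficient_density_line\<close>): the sum over \<open>i \<noteq> k\<close> of
  \<open>(q i * d k - q k * d i) * t * exp (- (q i * t)) * w' k (q k * t)\<close>, times the weights of the
  other types. So only the integral of the source matters, and summed over \<open>S\<close> the source is
  negative pointwise for \<open>\<theta> > 0\<close>. Since \<open>u\<close> is constant, \<open>q i * d k - q k * d i\<close> is a positive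
  multiple of \<open>q k - q i\<close>; and \<open>w' k x\<close> is \<open>exp (- x)\<close>, minus
  \<open>g x = exp (- x) * x ^ (j - 1) / (j - 1)!\<close> if \<open>k \<in> S\<close>. The exponentials alone are symmetric in
  \<open>i\<close> and \<open>k\<close>, and cancel against the antisymmetric \<open>q k - q i\<close>. Summed over all \<open>S\<close> of size
  \<open>m\<close>, the weight of the other types is symmetric too, so that symmetrization leaves minus a sum
  of nonnegative multiples of \<open>(q k - q i) * (exp (- (q i * t)) * g (q k * t) - exp (- (q k *
  t)) * g (q i * t))\<close> (\<open>sum_source_eq\<close>). Each of these is nonnegative because \<open>g x / exp (- x)\<close>
  increases with \<open>x\<close>, and positive if \<open>q i \<noteq> q k\<close>, where \<open>j \<ge> 2\<close> is used; the multiples are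
  positive for \<open>1 \<le> m \<le> N\<close>.

  This proves that the binomial moments decrease (\<open>choose_expectation_strict_antimono\<close>), and
  \<open>z ^ U = (\<Sum>m. (z - 1) ^ m * (U choose m))\<close> gives the generating function for \<open>z > 1\<close>. Both
  hold on the closed interval \<open>{0..1}\<close>, whose end points are the uniform vector and \<open>p\<close>.
\<close>

section \<open>Poisson weights\<close>

text \<open>
  The probability that a Poisson variable with mean \<open>x\<close> lies in \<open>{1..<j}\<close>.
\<close>

definition poisson_few :: "nat \<Rightarrow> real \<Rightarrow> real" where
  "poisson_few j x = exp (- x) * (\<Sum>c\<in>{1..<j}. x ^ c / fact c)"

text \<open>
  If type \<open>k\<close> has arrived a Poisson number of times with mean \<open>x\<close>, this is the probability that
  it is present and, when \<open>k \<in> S\<close>, still present fewer than \<open>j\<close> times.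
\<close>

definition poisson_weight :: "nat \<Rightarrow> nat set \<Rightarrow> nat \<Rightarrow> real \<Rightarrow> real" where
  "poisson_weight j S k x = (if k \<in> S then poisson_few j x else 1 - exp (- x))"

text \<open>
  Let the coupons arrive at the times of a Poisson process of rate \<open>1\<close>, so that the types arrive
  independently at rates \<open>q i\<close>. This is the density of the completion time on the event that
  every type in \<open>S\<close> occurs fewer than \<open>j\<close> times: \<open>i\<close> is the type that completes the first album
  at time \<open>t\<close>. There is no condition on the count of \<open>i\<close>, because it is \<open>1\<close>, which is less than
  \<open>j\<close> as soon as \<open>j \<ge> 2\<close>.
\<close>

definition deficient_density :: "nat \<Rightarrow> nat \<Rightarrow> nat set \<Rightarrow> (nat \<Rightarrow> real) \<Rightarrow> real \<Rightarrow> real" where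
  "deficient_density N j S q t =
     (\<Sum>i\<in>{1..N}. q i * exp (- (q i * t)) * (\<Prod>k\<in>{1..N} - {i}. poisson_weight j S k (q k * t)))"

text \<open>
  \<open>empty_spaces choose m\<close> counts the sets of \<open>m\<close> deficient types, whence the sum.
\<close>

definition choose_density :: "nat \<Rightarrow> nat \<Rightarrow> nat \<Rightarrow> (nat \<Rightarrow> real) \<Rightarrow> real \<Rightarrow> real" where
  "choose_density N j m q t = (\<Sum>S | S \<subseteq> {1..N} \<and> card S = m. deficient_density N j S q t)"

lemma poisson_few_nonneg: "0 \<le> x \<Longrightarrow> 0 \<le> poisson_few j x"
  by (simp add: poisson_few_def sum_nonneg)

lemma poisson_weight_nonneg: "0 \<le> x \<Longrightarrow> 0 \<le> poisson_weight j S k x"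
  by (simp add: poisson_weight_def poisson_few_nonneg)

lemma continuous_on_poisson_weight[continuous_intros]:
  fixes f :: "'a :: topological_space \<Rightarrow> real"
  shows "continuous_on A f \<Longrightarrow> continuous_on A (\<lambda>x. poisson_weight j S k (f x))"
  unfolding poisson_weight_def poisson_few_def
  by (cases "k \<in> S") (auto intro!: continuous_intros)

lemma continuous_on_choose_density: "continuous_on A (choose_density N j m q)"
  unfolding choose_density_def deficient_density_def by (intro continuous_intros)

section \<open>Counts of independent coupons\<close>

definition type_count :: "(nat \<Rightarrow> nat) \<Rightarrow> nat \<Rightarrow> nat \<Rightarrow> nat" where
  "type_count \<omega> n i = card {k. k < n \<and> \<omega> k = i}"

text \<open>
  The factor of a single type in the exponential generating function of weighted counts: the
  type has probability \<open>x\<close>, and being drawn \<open>c\<close> times has weight \<open>a c\<close>.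
\<close>

definition count_egf :: "real \<Rightarrow> (nat \<Rightarrow> real) \<Rightarrow> real fps" where
  "count_egf x a = Abs_fps (\<lambda>c. a c * x ^ c / fact c)"

lemma type_count_case_nat_Suc:
  "type_count (case_nat s \<omega>) (Suc n) i = (if i = s then Suc (type_count \<omega> n i) else type_count \<omega> n i)"
proof -
  have "{k. k < Suc n \<and> case_nat s \<omega> k = i} =
      (if i = s then {0} else {}) \<union> Suc ` {k. k < n \<and> \<omega> k = i}"
    (is "?L = ?R")
  proof (rule set_eqI)
    show "k \<in> ?L \<longleftrightarrow> k \<in> ?R" for k
      by (cases k) auto
  qed
  moreover have "card ({0} \<union> Suc ` A) = Suc (card A)" "card (Suc ` A) = card A" if "finite A" for A
    using that by (simp_all add: card_insert_if card_image)
  ultimately show ?thesis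
    by (simp add: type_count_def del: Un_insert_left)
qed

lemma fps_deriv_prod:
  fixes F :: "'a \<Rightarrow> 'b :: comm_ring_1 fps"
  assumes "finite A"
  shows "fps_deriv (\<Prod>x\<in>A. F x) = (\<Sum>x\<in>A. fps_deriv (F x) * (\<Prod>y\<in>A - {x}. F y))"
  using assms
proof (induction A rule: finite_induct)
  case (insert x A)
  have eq: "insert x A - {y} = insert x (A - {y})" if "y \<in> A" for y
    using insert.hyps that by auto
  show ?case
    using insert by (auto simp: sum_distrib_left eq algebra_simps intro!: sum.cong)
qed auto

lemma fps_deriv_count_egf: "fps_deriv (count_egf x a) = fps_const x * count_egf x (\<lambda>c. a (Suc c))"
  by (rule fps_ext) (simp add: count_egf_def field_simps del: of_nat_Suc)

text \<open>
  Differentiating a product of exponential generating functions removes one coupon: if its type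
  is \<open>s\<close>, a factor \<open>q s\<close> appears and the counts of \<open>s\<close> are shifted by one. This is the recursion
  that conditioning on the first coupon gives for the expected weights.
\<close>

lemma fact_Suc_prod_count_egf:
  assumes "finite A"
  shows "fact (Suc n) * fps_nth (\<Prod>k\<in>A. count_egf (q k) (a k)) (Suc n) =
    (\<Sum>s\<in>A. q s * (fact n * fps_nth (\<Prod>k\<in>A. count_egf (q k) ((a(s := (\<lambda>c. a s (Suc c)))) k)) n))"
proof -
  have "fact (Suc n) * fps_nth (\<Prod>k\<in>A. count_egf (q k) (a k)) (Suc n) =
    fact n * fps_nth (fps_deriv (\<Prod>k\<in>A. count_egf (q k) (a k))) n"
    by (simp add: algebra_simps)
  also have "fps_deriv (\<Prod>k\<in>A. count_egf (q k) (a k)) =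
     (\<Sum>s\<in>A. fps_const (q s) * (\<Prod>k\<in>A. count_egf (q k) ((a(s := (\<lambda>c. a s (Suc c)))) k)))"
    unfolding fps_deriv_prod[OF assms]
  proof (rule sum.cong[OF refl])
    fix s assume s: "s \<in> A"
    show "fps_deriv (count_egf (q s) (a s)) * (\<Prod>y\<in>A - {s}. count_egf (q y) (a y)) =
      fps_const (q s) * (\<Prod>k\<in>A. count_egf (q k) ((a(s := (\<lambda>c. a s (Suc c)))) k))"
      using s assms by (simp add: prod.remove[of A s] fps_deriv_count_egf mult.assoc)
  qed
  finally show ?thesis
    by (simp add: fps_sum_nth sum_distrib_left algebra_simps)
qed

lemma fps_nth_prod_0:
  fixes F :: "'a \<Rightarrow> 'b :: comm_ring_1 fps"
  shows "fps_nth (\<Prod>x\<in>A. F x) 0 = (\<Prod>x\<in>A. fps_nth (F x) 0)"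
  by (induction A rule: infinite_finite_induct) auto

lemma fps_nth_prod_nonneg:
  fixes F :: "'a \<Rightarrow> real fps"
  assumes "\<And>x n. x \<in> A \<Longrightarrow> 0 \<le> fps_nth (F x) n"
  shows "0 \<le> fps_nth (\<Prod>x\<in>A. F x) n"
  using assms
  by (induction A arbitrary: n rule: infinite_finite_induct)
     (auto simp: fps_mult_nth fps_one_nth intro!: sum_nonneg)

lemma sums_fps_prod:
  fixes F :: "'a \<Rightarrow> real fps"
  assumes "finite A" "\<And>x n. x \<in> A \<Longrightarrow> 0 \<le> fps_nth (F x) n" and t: "0 \<le> t"
    and "\<And>x. x \<in> A \<Longrightarrow> (\<lambda>n. fps_nth (F x) n * t ^ n) sums f x"
  shows "(\<lambda>n. fps_nth (\<Prod>x\<in>A. F x) n * t ^ n) sums (\<Prod>x\<in>A. f x)"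
  using assms(1,2,4)
proof (induction A rule: finite_induct)
  case empty
  have "(\<lambda>n. fps_nth (1 :: real fps) n * t ^ n) = (\<lambda>n. if n = 0 then 1 else 0)"
    by (auto simp: fps_one_nth)
  then show ?case
    using sums_single[of 0 "\<lambda>_. 1 :: real"] by simp
next
  case (insert x A)
  let ?a = "\<lambda>n. fps_nth (F x) n * t ^ n" and ?b = "\<lambda>n. fps_nth (\<Prod>x\<in>A. F x) n * t ^ n"
  have a: "?a sums f x" and b: "?b sums (\<Prod>x\<in>A. f x)"
    using insert by auto
  have "summable (\<lambda>n. norm (?a n))" "summable (\<lambda>n. norm (?b n))"
    using a b insert.prems(1) t fps_nth_prod_nonneg[of A F]
    by (auto simp: abs_mult sums_iff)
  then have "(\<lambda>n. \<Sum>i\<le>n. ?a i * ?b (n - i)) sums ((\<Sum>n. ?a n) * (\<Sum>n. ?b n))"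
    by (rule Cauchy_product_sums)
  moreover have "(\<Sum>i\<le>n. ?a i * ?b (n - i)) = fps_nth (\<Prod>x\<in>insert x A. F x) n * t ^ n" for n
  proof -
    have "?a i * ?b (n - i) = fps_nth (F x) i * fps_nth (\<Prod>x\<in>A. F x) (n - i) * t ^ n" if "i \<le> n" for i
    proof -
      have "t ^ n = t ^ i * t ^ (n - i)"
        using that by (simp flip: power_add)
      then show ?thesis by (simp add: algebra_simps)
    qed
    then show ?thesis
      using insert.hyps
      by (auto simp: fps_mult_nth sum_distrib_right atMost_atLeast0 intro!: sum.cong)
  qed
  ultimately show ?case
    using a b insert.hyps by (simp add: sums_iff)
qed

lemma measurable_type_count[measurable]:
  "(\<lambda>\<omega>. type_count \<omega> n i) \<in> coupon_space N q \<rightarrow>\<^sub>M count_space UNIV"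
proof -
  have "type_count \<omega> n i = (\<Sum>k<n. if \<omega> k = i then 1 else 0)" for \<omega>
    by (simp add: type_count_def sum.If_cases Int_def conj_commute lessThan_def)
  then show ?thesis
    unfolding coupon_space_def by simp
qed

lemma measurable_coupon[measurable]:
  "(\<lambda>\<omega>. \<omega> n) \<in> coupon_space N q \<rightarrow>\<^sub>M count_space UNIV"
  unfolding coupon_space_def by measurable

lemma nn_integral_coupon_space_first_step:
  assumes q: "is_prob_vector N q" and f[measurable]: "f \<in> borel_measurable (coupon_space N q)"
  shows "(\<integral>\<^sup>+\<omega>. f \<omega> \<partial>coupon_space N q) =
    (\<Sum>s\<in>{1..N}. ennreal (q s) * (\<integral>\<^sup>+\<omega>. f (case_nat s \<omega>) \<partial>coupon_space N q))"
proof -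
  let ?M = "measure_pmf (coupon_pmf N q)"
  interpret P: sequence_space ?M
    by unfold_locales
  have [measurable]: "f \<in> borel_measurable P.S" using f by (simp add: coupon_space_def)
  have [measurable]: "(\<lambda>(s, \<omega>). case_nat s \<omega>) \<in> ?M \<Otimes>\<^sub>M P.S \<rightarrow>\<^sub>M P.S"
    by measurable
  have "(\<integral>\<^sup>+\<omega>. f \<omega> \<partial>coupon_space N q) = (\<integral>\<^sup>+\<omega>. f \<omega> \<partial>distr (?M \<Otimes>\<^sub>M P.S) P.S (\<lambda>(s, \<omega>). case_nat s \<omega>))"
    by (simp add: P.PiM_iter coupon_space_def)
  also have "\<dots> = (\<integral>\<^sup>+x. f (case x of (s, \<omega>) \<Rightarrow> case_nat s \<omega>) \<partial>(?M \<Otimes>\<^sub>M P.S))"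
    by (rule nn_integral_distr) measurable
  also have "\<dots> = (\<integral>\<^sup>+s. \<integral>\<^sup>+\<omega>. f (case_nat s \<omega>) \<partial>P.S \<partial>?M)"
    by (subst P.P.nn_integral_fst[symmetric]) (auto simp: split_beta')
  also have "\<dots> = (\<Sum>s\<in>{1..N}. (\<integral>\<^sup>+\<omega>. f (case_nat s \<omega>) \<partial>P.S) * pmf (coupon_pmf N q) s)"
    by (rule nn_integral_measure_pmf_support) (auto simp: set_pmf_iff pmf_coupon_pmf[OF q] split: if_splits)
  also have "\<dots> = (\<Sum>s\<in>{1..N}. ennreal (q s) * (\<integral>\<^sup>+\<omega>. f (case_nat s \<omega>) \<partial>coupon_space N q))"
    by (intro sum.cong) (auto simp: pmf_coupon_pmf[OF q] coupon_space_def mult.commute)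
  finally show ?thesis .
qed

lemma measurable_count_weights[measurable]:
  "(\<lambda>\<omega>. ennreal ((\<Prod>k\<in>K. a k (type_count \<omega> n k)) * indicator {i} (\<omega> n)))
    \<in> borel_measurable (coupon_space N q)"
proof -
  have "(\<lambda>\<omega>. a k (type_count \<omega> n k) :: real) \<in> borel_measurable (coupon_space N q)" for k
    by (rule measurable_compose[OF measurable_type_count]) simp
  moreover have "(\<lambda>\<omega>. indicator {i} (\<omega> n) :: real) \<in> borel_measurable (coupon_space N q)"
    by (rule measurable_compose[OF measurable_coupon]) simp
  ultimately show ?thesis
    by measurable
qed

text \<open>
  The weights \<open>a\<close> are arbitrary because the induction on \<open>n\<close> conditions on the first coupon,
  which shifts the weight of its type; \<open>fact_Suc_prod_count_egf\<close> is the matching recursion for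
  the coefficients. Coupon number \<open>n + 1\<close> is independent of the first \<open>n\<close>, and contributes the
  factor \<open>q i\<close>.
\<close>

lemma nn_integral_count_weights:
  assumes q: "is_prob_vector N q" and i: "i \<in> {1..N}" and a: "\<And>k c. 0 \<le> a k c"
  shows "(\<integral>\<^sup>+\<omega>. ennreal ((\<Prod>k\<in>{1..N}. a k (type_count \<omega> n k)) * indicator {i} (\<omega> n)) \<partial>coupon_space N q)
    = ennreal (q i * (fact n * fps_nth (\<Prod>k\<in>{1..N}. count_egf (q k) (a k)) n))"
  using a
proof (induction n arbitrary: a)
  case 0
  interpret prob_space "coupon_space N q" by (rule prob_space_coupon_space)
  let ?c = "\<Prod>k\<in>{1..N}. a k 0"
  have "(\<integral>\<^sup>+\<omega>. ennreal ((\<Prod>k\<in>{1..N}. a k (type_count \<omega> 0 k)) * indicator {i} (\<omega> 0)) \<partial>coupon_space N q)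
     = (\<Sum>s\<in>{1..N}. ennreal (q s) * ennreal (?c * indicator {i} s))"
    by (subst nn_integral_coupon_space_first_step[OF q measurable_count_weights])
       (simp add: type_count_def emeasure_space_1)
  also have "\<dots> = (\<Sum>s\<in>{1..N}. if s = i then ennreal (q i) * ennreal ?c else 0)"
    by (intro sum.cong) auto
  also have "\<dots> = ennreal (q i * ?c)"
    using i q by (simp add: ennreal_mult' is_prob_vector_def)
  also have "?c = fps_nth (\<Prod>k\<in>{1..N}. count_egf (q k) (a k)) 0"
    by (simp add: fps_nth_prod_0 count_egf_def)
  finally show ?case by simp
next
  case (Suc n)
  let ?a = "\<lambda>s. a(s := (\<lambda>c. a s (Suc c)))"
  have q0: "0 \<le> q k" if "k \<in> {1..N}" for k using q that by (auto simp: is_prob_vector_def)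
  have nn: "0 \<le> fps_nth (\<Prod>k\<in>{1..N}. count_egf (q k) (?a s k)) n" for s
    using Suc.prems q0 by (intro fps_nth_prod_nonneg) (auto simp: count_egf_def intro!: divide_nonneg_nonneg mult_nonneg_nonneg)
  have "(\<integral>\<^sup>+\<omega>. ennreal ((\<Prod>k\<in>{1..N}. a k (type_count \<omega> (Suc n) k)) * indicator {i} (\<omega> (Suc n))) \<partial>coupon_space N q)
     = (\<Sum>s\<in>{1..N}. ennreal (q s) *
          (\<integral>\<^sup>+\<omega>. ennreal ((\<Prod>k\<in>{1..N}. ?a s k (type_count \<omega> n k)) * indicator {i} (\<omega> n)) \<partial>coupon_space N q))"
  proof -
    have "a k (type_count (case_nat s \<omega>) (Suc n) k) = ?a s k (type_count \<omega> n k)" for k s \<omega>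
      by (simp add: type_count_case_nat_Suc)
    then show ?thesis
      by (subst nn_integral_coupon_space_first_step[OF q measurable_count_weights]) simp
  qed
  also have "\<dots> = (\<Sum>s\<in>{1..N}. ennreal (q s) * ennreal (q i * (fact n * fps_nth (\<Prod>k\<in>{1..N}. count_egf (q k) (?a s k)) n)))"
    by (subst Suc.IH) (use Suc.prems in auto)
  also have "\<dots> = ennreal (\<Sum>s\<in>{1..N}. q s * (q i * (fact n * fps_nth (\<Prod>k\<in>{1..N}. count_egf (q k) (?a s k)) n)))"
  proof -
    have X0: "0 \<le> q i * (fact n * fps_nth (\<Prod>k\<in>{1..N}. count_egf (q k) (?a s k)) n)" for s
      using q0[OF i] nn[of s] by (intro mult_nonneg_nonneg) simp_all
    have "(\<Sum>s\<in>{1..N}. ennreal (q s) * ennreal (q i * (fact n * fps_nth (\<Prod>k\<in>{1..N}. count_egf (q k) (?a s k)) n)))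
       = (\<Sum>s\<in>{1..N}. ennreal (q s * (q i * (fact n * fps_nth (\<Prod>k\<in>{1..N}. count_egf (q k) (?a s k)) n))))"
      by (intro sum.cong refl ennreal_mult'[symmetric] q0)
    also have "\<dots> = ennreal (\<Sum>s\<in>{1..N}. q s * (q i * (fact n * fps_nth (\<Prod>k\<in>{1..N}. count_egf (q k) (?a s k)) n)))"
      by (intro sum_ennreal mult_nonneg_nonneg[OF q0 X0])
    finally show ?thesis .
  qed
  also have "\<dots> = ennreal (q i * (fact (Suc n) * fps_nth (\<Prod>k\<in>{1..N}. count_egf (q k) (a k)) (Suc n)))"
    unfolding fact_Suc_prod_count_egf[OF finite_atLeastAtMost] sum_distrib_left
    by (simp only: mult.left_commute)
  finally show ?case .
qed

section \<open>The binomial moments as integrals over Poisson time\<close>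

text \<open>
  The condition on the count of type \<open>k\<close> just before type \<open>i\<close> completes the first album, on the
  event that all types in \<open>S\<close> occur fewer than \<open>j\<close> times.
\<close>

definition admissible :: "nat \<Rightarrow> nat set \<Rightarrow> nat \<Rightarrow> nat \<Rightarrow> nat \<Rightarrow> bool" where
  "admissible j S i k c \<longleftrightarrow> (if k = i then c = 0 else 1 \<le> c \<and> (k \<in> S \<longrightarrow> c < j))"

lemma type_count_eq_0_iff: "type_count \<omega> n i = 0 \<longleftrightarrow> (\<forall>k<n. \<omega> k \<noteq> i)"
  by (auto simp: type_count_def)

lemma type_count_pos_iff: "1 \<le> type_count \<omega> n i \<longleftrightarrow> (\<exists>k<n. \<omega> k = i)"
  using type_count_eq_0_iff[of \<omega> n i] by (auto simp: Suc_le_eq)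

lemma type_count_Suc:
  "type_count \<omega> (Suc n) i = (if \<omega> n = i then Suc (type_count \<omega> n i) else type_count \<omega> n i)"
proof -
  have "{k. k < Suc n \<and> \<omega> k = i} =
      (if \<omega> n = i then insert n {k. k < n \<and> \<omega> k = i} else {k. k < n \<and> \<omega> k = i})"
    by (auto simp: less_Suc_eq)
  then show ?thesis by (simp add: type_count_def)
qed

lemma prod_of_bool: "finite A \<Longrightarrow> (\<Prod>x\<in>A. of_bool (P x)) = (of_bool (\<forall>x\<in>A. P x) :: real)"
  by (induction A rule: finite_induct) auto

lemma completion_time_eq_Suc_iff:
  assumes "1 \<le> N" and ex: "\<exists>n. \<forall>i\<in>{1..N}. \<exists>k<n. \<omega> k = i"
  shows "completion_time N \<omega> = Suc n \<longleftrightarrow>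
    \<omega> n \<in> {1..N} \<and> type_count \<omega> n (\<omega> n) = 0 \<and> (\<forall>k\<in>{1..N}. k \<noteq> \<omega> n \<longrightarrow> 1 \<le> type_count \<omega> n k)"
    (is "_ = ?R")
proof
  assume R: ?R
  show "completion_time N \<omega> = Suc n"
    unfolding completion_time_def
  proof (rule Least_equality)
    show "\<forall>i\<in>{1..N}. \<exists>k<Suc n. \<omega> k = i"
      using R unfolding type_count_pos_iff by (metis less_Suc_eq)
    show "Suc n \<le> m" if m: "\<forall>i\<in>{1..N}. \<exists>k<m. \<omega> k = i" for m
    proof (rule ccontr)
      assume "\<not> Suc n \<le> m"
      moreover obtain k where "k < m" "\<omega> k = \<omega> n" using m R by blast
      ultimately show False using R unfolding type_count_eq_0_iff by (meson less_le_trans not_less_eq_eq)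
    qed
  qed
next
  assume T: "completion_time N \<omega> = Suc n"
  have all: "\<forall>i\<in>{1..N}. \<exists>k<Suc n. \<omega> k = i"
    using LeastI_ex[OF ex] T unfolding completion_time_def by simp
  have "\<not> (\<forall>i\<in>{1..N}. \<exists>k<n. \<omega> k = i)"
    using not_less_Least[of n "\<lambda>n. \<forall>i\<in>{1..N}. \<exists>k<n. \<omega> k = i"] T unfolding completion_time_def by simp
  then obtain i where i: "i \<in> {1..N}" "\<forall>k<n. \<omega> k \<noteq> i" by blast
  with all have "\<omega> n = i" by (metis less_Suc_eq)
  with i all show ?R
    unfolding type_count_eq_0_iff type_count_pos_iff by (metis less_Suc_eq)
qed

lemma completion_time_pos:
  assumes "1 \<le> N" and ex: "\<exists>n. \<forall>i\<in>{1..N}. \<exists>k<n. \<omega> k = i"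
  shows "completion_time N \<omega> \<noteq> 0"
  using LeastI_ex[OF ex] \<open>1 \<le> N\<close> unfolding completion_time_def[symmetric] by force

text \<open>
  The event is split according to the last coupon: exactly one pair \<open>(n, i)\<close>, the index and the
  type of the completing coupon, can contribute.
\<close>

lemma deficient_indicator_eq_suminf:
  assumes N: "1 \<le> N" and j: "2 \<le> j" and S: "S \<subseteq> {1..N}"
    and ex: "\<exists>n. \<forall>i\<in>{1..N}. \<exists>k<n. \<omega> k = i"
  shows "(\<Sum>n. \<Sum>i\<in>{1..N}. ennreal ((\<Prod>k\<in>{1..N}. of_bool (admissible j S i k (type_count \<omega> n k))) * indicator {i} (\<omega> n)))
    = (of_bool (\<forall>k\<in>S. type_count \<omega> (completion_time N \<omega>) k < j) :: ennreal)"
proof -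
  obtain n0 where n0: "completion_time N \<omega> = Suc n0"
    using completion_time_pos[OF N ex] not0_implies_Suc by blast
  let ?D = "\<forall>k\<in>S. type_count \<omega> (completion_time N \<omega>) k < j"
  have D_iff: "?D \<longleftrightarrow> (\<forall>k\<in>S. k \<noteq> \<omega> n0 \<longrightarrow> type_count \<omega> n0 k < j)"
    using completion_time_eq_Suc_iff[OF N ex, of n0] n0 j by (auto simp: type_count_Suc)
  have adm: "(\<forall>k\<in>{1..N}. admissible j S i k (type_count \<omega> n k)) \<and> \<omega> n = i \<longleftrightarrow> i = \<omega> n0 \<and> n = n0 \<and> ?D"
    if "i \<in> {1..N}" for i n
  proof -
    have "(\<forall>k\<in>{1..N}. admissible j S i k (type_count \<omega> n k)) \<and> \<omega> n = i \<longleftrightarrow>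
       i = \<omega> n \<and> completion_time N \<omega> = Suc n \<and> (\<forall>k\<in>S. k \<noteq> \<omega> n \<longrightarrow> type_count \<omega> n k < j)"
      unfolding completion_time_eq_Suc_iff[OF N ex] admissible_def using S that by auto
    then show ?thesis
      unfolding D_iff using n0 by auto
  qed
  have "ennreal ((\<Prod>k\<in>{1..N}. of_bool (admissible j S i k (type_count \<omega> n k))) * indicator {i} (\<omega> n))
     = (if i = \<omega> n0 then if n = n0 then of_bool ?D else 0 else 0)" if "i \<in> {1..N}" for i n
  proof -
    have "(\<Prod>k\<in>{1..N}. of_bool (admissible j S i k (type_count \<omega> n k))) * indicator {i} (\<omega> n)
      = (of_bool ((\<forall>k\<in>{1..N}. admissible j S i k (type_count \<omega> n k)) \<and> \<omega> n = i) :: real)"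
      by (subst prod_of_bool) (simp_all add: indicator_def)
    then show ?thesis
      unfolding adm[OF that] by (auto simp: of_bool_def)
  qed
  then have "(\<Sum>i\<in>{1..N}. ennreal ((\<Prod>k\<in>{1..N}. of_bool (admissible j S i k (type_count \<omega> n k))) * indicator {i} (\<omega> n)))
     = (if n = n0 then of_bool ?D else 0)" for n
    using completion_time_eq_Suc_iff[OF N ex, of n0] n0 by (simp del: atLeastAtMost_iff)
  then show ?thesis
    using sums_unique[OF sums_single[of n0 "\<lambda>_. of_bool ?D :: ennreal"]] by simp
qed

lemma sums_count_egf_admissible:
  "(\<lambda>c. fps_nth (count_egf x (\<lambda>c. of_bool (admissible j S i k c))) c * t ^ c) sums
     (exp (x * t) * (if k = i then exp (- (x * t)) else poisson_weight j S k (x * t)))"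
proof -
  have *: "fps_nth (count_egf x (\<lambda>c. of_bool (admissible j S i k c))) c * t ^ c =
     (if admissible j S i k c then (x * t) ^ c / fact c else 0)" for c
    by (simp add: count_egf_def power_mult_distrib)
  have e: "exp y * (exp (- y) * r) = r" "exp y * (1 - exp (- y)) = exp y - 1" for y r :: real
    by (simp_all add: exp_minus field_simps)
  consider "k = i" | "k \<noteq> i" "k \<in> S" | "k \<noteq> i" "k \<notin> S" by blast
  then show ?thesis
  proof cases
    case 1
    then show ?thesis
      using sums_single[of 0 "\<lambda>c. (x * t) ^ c / fact c"] unfolding *
      by (simp add: admissible_def exp_minus)
  next
    case 2
    have "(\<lambda>c. if c \<in> {1..<j} then (x * t) ^ c / fact c else 0) sums (\<Sum>c\<in>{1..<j}. (x * t) ^ c / fact c)"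
      by (rule sums_If_finite_set) simp
    with 2 show ?thesis
      unfolding * poisson_weight_def poisson_few_def e by (simp add: admissible_def e)
  next
    case 3
    have "(\<lambda>c. (x * t) ^ c / fact c - (if c = 0 then (x * t) ^ c / fact c else 0)) sums (exp (x * t) - (x * t) ^ 0 / fact 0)"
      using exp_converges[of "x * t"] by (intro sums_diff sums_single) (simp add: field_simps)
    also have "(\<lambda>c. (x * t) ^ c / fact c - (if c = 0 then (x * t) ^ c / fact c else 0))
        = (\<lambda>c. if admissible j S i k c then (x * t) ^ c / fact c else 0)"
      using 3 by (auto simp: admissible_def fun_eq_iff)
    finally show ?thesis
      using 3 unfolding * poisson_weight_def e by (simp add: e)
  qed
qed

text \<open>
  Splitting by the completing coupon gives a series over \<open>n\<close> of terms \<open>n!\<close> times a coefficient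
  of a product of generating functions. Writing \<open>n!\<close> as the integral of \<open>t ^ n * exp (- t)\<close> sums
  the series under the integral to the product itself, one factor per type, and
  \<open>exp (- t) = (\<Prod>k. exp (- (q k * t)))\<close> turns the factors into Poisson probabilities.
\<close>

lemma nn_integral_deficient:
  assumes N: "1 \<le> N" and j: "2 \<le> j" and S: "S \<subseteq> {1..N}"
    and q: "is_prob_vector N q" and pos: "\<forall>i\<in>{1..N}. 0 < q i"
  shows "(\<integral>\<^sup>+\<omega>. of_bool (\<forall>k\<in>S. type_count \<omega> (completion_time N \<omega>) k < j) \<partial>coupon_space N q)
    = (\<integral>\<^sup>+t. ennreal (deficient_density N j S q t) * indicator {0..} t \<partial>lborel)"
proof -
  let ?w = "\<lambda>i n \<omega>. ennreal ((\<Prod>k\<in>{1..N}. of_bool (admissible j S i k (type_count \<omega> n k))) * indicator {i} (\<omega> n))"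
  define C where "C = (\<lambda>i n. fps_nth (\<Prod>k\<in>{1..N}. count_egf (q k) (\<lambda>c. of_bool (admissible j S i k c))) n)"
  have q0: "0 \<le> q i" if "i \<in> {1..N}" for i using pos that by (auto simp: less_imp_le)
  have egf0: "0 \<le> fps_nth (count_egf (q k) (\<lambda>c. of_bool (admissible j S i k c))) n" if "k \<in> {1..N}" for i k n
    using q0[OF that] by (auto simp: count_egf_def)
  have C0: "0 \<le> C i n" for i n
    unfolding C_def using egf0 by (rule fps_nth_prod_nonneg)
  have "(\<integral>\<^sup>+\<omega>. of_bool (\<forall>k\<in>S. type_count \<omega> (completion_time N \<omega>) k < j) \<partial>coupon_space N q)
     = (\<integral>\<^sup>+\<omega>. (\<Sum>n. \<Sum>i\<in>{1..N}. ?w i n \<omega>) \<partial>coupon_space N q)"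
  proof (rule nn_integral_cong_AE)
    show "AE \<omega> in coupon_space N q. of_bool (\<forall>k\<in>S. type_count \<omega> (completion_time N \<omega>) k < j)
        = (\<Sum>n. \<Sum>i\<in>{1..N}. ?w i n \<omega>)"
      using AE_all_types_appear[OF q pos]
      by (rule eventually_mono) (rule deficient_indicator_eq_suminf[OF N j S, symmetric])
  qed
  also have "\<dots> = (\<Sum>n. \<Sum>i\<in>{1..N}. \<integral>\<^sup>+\<omega>. ?w i n \<omega> \<partial>coupon_space N q)"
  proof -
    have "(\<integral>\<^sup>+\<omega>. (\<Sum>i\<in>{1..N}. ?w i n \<omega>) \<partial>coupon_space N q) = (\<Sum>i\<in>{1..N}. \<integral>\<^sup>+\<omega>. ?w i n \<omega> \<partial>coupon_space N q)" for n
      by (rule nn_integral_sum) (rule measurable_count_weights)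
    moreover have "(\<integral>\<^sup>+\<omega>. (\<Sum>n. \<Sum>i\<in>{1..N}. ?w i n \<omega>) \<partial>coupon_space N q) = (\<Sum>n. \<integral>\<^sup>+\<omega>. (\<Sum>i\<in>{1..N}. ?w i n \<omega>) \<partial>coupon_space N q)"
      by (intro nn_integral_suminf borel_measurable_sum measurable_count_weights)
    ultimately show ?thesis by simp
  qed
  also have "\<dots> = (\<Sum>n. \<Sum>i\<in>{1..N}. ennreal (q i * (fact n * C i n)))"
    unfolding C_def
    by (intro suminf_cong sum.cong refl nn_integral_count_weights[OF q]) simp_all
  also have "\<dots> = (\<Sum>n. \<Sum>i\<in>{1..N}. \<integral>\<^sup>+t. ennreal (q i * C i n) * (ennreal (t ^ n * exp (- t)) * indicator {0..} t) \<partial>lborel)"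
  proof (intro suminf_cong sum.cong refl)
    fix n i assume i: "i \<in> {1..N}"
    have "(\<integral>\<^sup>+t. ennreal (q i * C i n) * (ennreal (t ^ n * exp (- t)) * indicator {0..} t) \<partial>lborel)
      = ennreal (q i * C i n) * ennreal (real (fact n))"
      by (subst nn_integral_cmult) (simp_all add: nn_intergal_power_times_exp_Ici)
    also have "\<dots> = ennreal (q i * C i n * real (fact n))"
      by (rule ennreal_mult'[symmetric]) (rule mult_nonneg_nonneg[OF q0[OF i] C0])
    also have "q i * C i n * real (fact n) = q i * (fact n * C i n)"
      by simp
    finally show "ennreal (q i * (fact n * C i n)) = (\<integral>\<^sup>+t. ennreal (q i * C i n) * (ennreal (t ^ n * exp (- t)) * indicator {0..} t) \<partial>lborel)"
      by (rule sym)
  qed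
  also have "\<dots> = (\<integral>\<^sup>+t. (\<Sum>n. \<Sum>i\<in>{1..N}. ennreal (q i * C i n) * (ennreal (t ^ n * exp (- t)) * indicator {0..} t)) \<partial>lborel)"
    by (subst nn_integral_suminf, simp, subst nn_integral_sum) simp_all
  also have "\<dots> = (\<integral>\<^sup>+t. ennreal (deficient_density N j S q t) * indicator {0..} t \<partial>lborel)"
  proof (rule nn_integral_cong)
    fix t :: real
    show "(\<Sum>n. \<Sum>i\<in>{1..N}. ennreal (q i * C i n) * (ennreal (t ^ n * exp (- t)) * indicator {0..} t))
       = ennreal (deficient_density N j S q t) * indicator {0..} t"
    proof (cases "0 \<le> t")
      case t: True
      have "(\<lambda>n. C i n * t ^ n) sums (\<Prod>k\<in>{1..N}. exp (q k * t) * (if k = i then exp (- (q k * t)) else poisson_weight j S k (q k * t)))" for i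
        unfolding C_def using egf0 t sums_count_egf_admissible by (intro sums_fps_prod) auto
      then have "(\<lambda>n. \<Sum>i\<in>{1..N}. q i * exp (- t) * (C i n * t ^ n)) sums
         (\<Sum>i\<in>{1..N}. q i * exp (- t) * (\<Prod>k\<in>{1..N}. exp (q k * t) * (if k = i then exp (- (q k * t)) else poisson_weight j S k (q k * t))))"
        by (intro sums_sum sums_mult)
      also have "(\<Sum>i\<in>{1..N}. q i * exp (- t) * (\<Prod>k\<in>{1..N}. exp (q k * t) * (if k = i then exp (- (q k * t)) else poisson_weight j S k (q k * t))))
         = deficient_density N j S q t"
        unfolding deficient_density_def
      proof (rule sum.cong[OF refl])
        fix i assume i: "i \<in> {1..N}"
        have "(\<Prod>k\<in>{1..N}. exp (q k * t)) = exp t"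
          using q by (simp add: exp_sum[symmetric] sum_distrib_right[symmetric] is_prob_vector_def)
        moreover have "(\<Prod>k\<in>{1..N}. if k = i then exp (- (q k * t)) else poisson_weight j S k (q k * t))
           = exp (- (q i * t)) * (\<Prod>k\<in>{1..N} - {i}. poisson_weight j S k (q k * t))"
          using i by (subst prod.remove[of _ i]) (auto intro!: prod.cong)
        ultimately show "q i * exp (- t) * (\<Prod>k\<in>{1..N}. exp (q k * t) * (if k = i then exp (- (q k * t)) else poisson_weight j S k (q k * t)))
          = q i * exp (- (q i * t)) * (\<Prod>k\<in>{1..N} - {i}. poisson_weight j S k (q k * t))"
          by (simp add: prod.distrib exp_minus field_simps)
      qed
      finally have sm: "(\<lambda>n. \<Sum>i\<in>{1..N}. q i * exp (- t) * (C i n * t ^ n)) sums deficient_density N j S q t" .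
      have term_eq: "(\<Sum>i\<in>{1..N}. ennreal (q i * C i n) * (ennreal (t ^ n * exp (- t)) * indicator {0..} t))
         = ennreal (\<Sum>i\<in>{1..N}. q i * exp (- t) * (C i n * t ^ n))" for n
      proof -
        have "ennreal (q i * C i n) * (ennreal (t ^ n * exp (- t)) * indicator {0..} t)
           = ennreal (q i * exp (- t) * (C i n * t ^ n))" if "i \<in> {1..N}" for i
        proof -
          have "ennreal (q i * C i n) * (ennreal (t ^ n * exp (- t)) * indicator {0..} t)
            = ennreal (q i * C i n * (t ^ n * exp (- t)))"
            using t mult_nonneg_nonneg[OF q0[OF that] C0] by (simp add: ennreal_mult')
          then show ?thesis by (simp add: mult_ac)
        qed
        moreover have "0 \<le> q i * exp (- t) * (C i n * t ^ n)" if "i \<in> {1..N}" for i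
          using t q0[OF that] C0 by (intro mult_nonneg_nonneg) auto
        ultimately show ?thesis
          by (simp del: atLeastAtMost_iff)
      qed
      have nn: "0 \<le> (\<Sum>i\<in>{1..N}. q i * exp (- t) * (C i n * t ^ n))" for n
        using t q0 C0 by (intro sum_nonneg mult_nonneg_nonneg) auto
      show ?thesis
        unfolding term_eq suminf_ennreal_eq[OF nn sm] using t by simp
    qed simp
  qed
  finally show ?thesis .
qed

lemma deficient_density_nonneg:
  assumes "\<forall>i\<in>{1..N}. 0 < q i" "0 \<le> t"
  shows "0 \<le> deficient_density N j S q t"
  unfolding deficient_density_def
  using assms by (intro sum_nonneg mult_nonneg_nonneg prod_nonneg ballI poisson_weight_nonneg) (auto simp: less_imp_le)

lemma choose_density_nonneg:
  assumes "\<forall>i\<in>{1..N}. 0 < q i" "0 \<le> t"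
  shows "0 \<le> choose_density N j m q t"
  unfolding choose_density_def by (intro sum_nonneg deficient_density_nonneg assms)

lemma binomial_eq_sum_subsets:
  assumes "finite A" "B \<subseteq> A"
  shows "card B choose m = (\<Sum>S | S \<subseteq> A \<and> card S = m. of_bool (S \<subseteq> B))"
proof -
  have "finite B" using assms finite_subset by blast
  have "card B choose m = card {S. S \<subseteq> B \<and> card S = m}"
    using n_subsets[OF \<open>finite B\<close>] by simp
  also have "{S. S \<subseteq> B \<and> card S = m} = {S. S \<subseteq> A \<and> card S = m} \<inter> {S. S \<subseteq> B}"
    using assms by auto
  also have "card \<dots> = (\<Sum>S | S \<subseteq> A \<and> card S = m. of_bool (S \<subseteq> B))"
    using assms by (simp add: sum_of_bool_eq)
  finally show ?thesis .
qed

lemma empty_spaces_le: "empty_spaces N j \<omega> \<le> N"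
  unfolding empty_spaces_def using card_mono[of "{1..N}" "{1..N} - A" for A] by simp

lemma measurable_completion_time[measurable]:
  "completion_time N \<in> coupon_space N q \<rightarrow>\<^sub>M count_space UNIV"
  unfolding completion_time_def[abs_def] by measurable

lemma measurable_type_count_completion[measurable]:
  "(\<lambda>\<omega>. type_count \<omega> (completion_time N \<omega>) i) \<in> coupon_space N q \<rightarrow>\<^sub>M count_space UNIV"
  by (rule measurable_compose_countable) measurable

lemma binomial_empty_spaces:
  assumes "1 \<le> j"
  shows "empty_spaces N j \<omega> choose m =
    (\<Sum>S | S \<subseteq> {1..N} \<and> card S = m. of_bool (\<forall>k\<in>S. type_count \<omega> (completion_time N \<omega>) k < j))"
  unfolding empty_spaces_eq_card_count_less[OF assms] type_count_def[symmetric]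
  by (subst binomial_eq_sum_subsets[of "{1..N}"]) (auto intro!: sum.cong simp: subset_iff)

lemma measurable_empty_spaces:
  assumes "1 \<le> j"
  shows "empty_spaces N j \<in> coupon_space N q \<rightarrow>\<^sub>M count_space UNIV"
proof -
  have "empty_spaces N j \<omega> = (\<Sum>i\<in>{1..N}. if type_count \<omega> (completion_time N \<omega>) i < j then 1 else 0)" for \<omega>
    unfolding empty_spaces_eq_card_count_less[OF assms] type_count_def[symmetric]
    by (simp add: sum.If_cases Int_def)
  then have "empty_spaces N j = (\<lambda>\<omega>. \<Sum>i\<in>{1..N}. if type_count \<omega> (completion_time N \<omega>) i < j then 1 else 0)"
    by (rule ext)
  then show ?thesis by simp
qed

lemma integrable_empty_spaces:
  fixes f :: "nat \<Rightarrow> real"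
  assumes "1 \<le> j"
  shows "integrable (coupon_space N q) (\<lambda>\<omega>. f (empty_spaces N j \<omega>))"
proof -
  interpret prob_space "coupon_space N q" by (rule prob_space_coupon_space)
  show ?thesis
  proof (rule integrable_const_bound[where B="\<Sum>u\<le>N. \<bar>f u\<bar>"])
    show "AE \<omega> in coupon_space N q. norm (f (empty_spaces N j \<omega>)) \<le> (\<Sum>u\<le>N. \<bar>f u\<bar>)"
      using empty_spaces_le by (intro AE_I2) (auto intro!: member_le_sum)
    show "(\<lambda>\<omega>. f (empty_spaces N j \<omega>)) \<in> borel_measurable (coupon_space N q)"
      by (rule measurable_compose[OF measurable_empty_spaces[OF assms]]) simp
  qed
qed

lemma nn_integral_binomial_empty_spaces:
  assumes N: "1 \<le> N" and j: "2 \<le> j"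
    and q: "is_prob_vector N q" and pos: "\<forall>i\<in>{1..N}. 0 < q i"
  shows "ennreal (coupon_expectation N q (\<lambda>\<omega>. real (empty_spaces N j \<omega> choose m)))
    = (\<integral>\<^sup>+t. ennreal (choose_density N j m q t) * indicator {0..} t \<partial>lborel)"
proof -
  have [measurable]: "deficient_density N j S q \<in> borel_measurable borel" for S
    unfolding deficient_density_def
    by (intro borel_measurable_continuous_onI continuous_intros)
  have "ennreal (coupon_expectation N q (\<lambda>\<omega>. real (empty_spaces N j \<omega> choose m)))
     = (\<integral>\<^sup>+\<omega>. ennreal (real (empty_spaces N j \<omega> choose m)) \<partial>coupon_space N q)"
    unfolding coupon_expectation_def
    using j by (intro nn_integral_eq_integral[symmetric] integrable_empty_spaces) auto
  also have "\<dots> = (\<integral>\<^sup>+\<omega>. (\<Sum>S | S \<subseteq> {1..N} \<and> card S = m.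
      of_bool (\<forall>k\<in>S. type_count \<omega> (completion_time N \<omega>) k < j)) \<partial>coupon_space N q)"
    using j by (simp add: binomial_empty_spaces flip: ennreal_of_nat_eq_real_of_nat)
  also have "\<dots> = (\<Sum>S | S \<subseteq> {1..N} \<and> card S = m.
      \<integral>\<^sup>+\<omega>. of_bool (\<forall>k\<in>S. type_count \<omega> (completion_time N \<omega>) k < j) \<partial>coupon_space N q)"
  proof (rule nn_integral_sum)
    fix S assume "S \<in> {S. S \<subseteq> {1..N} \<and> card S = m}"
    then have "finite S" by (auto intro: finite_subset)
    then show "(\<lambda>\<omega>. of_bool (\<forall>k\<in>S. type_count \<omega> (completion_time N \<omega>) k < j) :: ennreal) \<in> borel_measurable (coupon_space N q)"
      unfolding of_bool_def by measurable
  qed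
  also have "\<dots> = (\<Sum>S | S \<subseteq> {1..N} \<and> card S = m.
      \<integral>\<^sup>+t. ennreal (deficient_density N j S q t) * indicator {0..} t \<partial>lborel)"
    by (intro sum.cong refl nn_integral_deficient[OF N j _ q pos]) auto
  also have "\<dots> = (\<integral>\<^sup>+t. (\<Sum>S | S \<subseteq> {1..N} \<and> card S = m.
      ennreal (deficient_density N j S q t) * indicator {0..} t) \<partial>lborel)"
    by (rule nn_integral_sum[symmetric]) simp
  also have "\<dots> = (\<integral>\<^sup>+t. ennreal (choose_density N j m q t) * indicator {0..} t \<partial>lborel)"
    by (intro nn_integral_cong)
       (auto simp: choose_density_def indicator_def deficient_density_nonneg[OF pos])
  finally show ?thesis .
qed

lemma tendsto_integral_choose_density:
  assumes N: "1 \<le> N" and j: "2 \<le> j"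
    and q: "is_prob_vector N q" and pos: "\<forall>i\<in>{1..N}. 0 < q i"
  shows "((\<lambda>R. integral {0..R} (choose_density N j m q)) \<longlongrightarrow>
    coupon_expectation N q (\<lambda>\<omega>. real (empty_spaces N j \<omega> choose m))) at_top"
proof -
  let ?E = "coupon_expectation N q (\<lambda>\<omega>. real (empty_spaces N j \<omega> choose m))"
  define f where "f = (\<lambda>t. indicator {0..} t * choose_density N j m q t)"
  have E0: "0 \<le> ?E"
    unfolding coupon_expectation_def by (rule Bochner_Integration.integral_nonneg) simp
  have meas[measurable]: "choose_density N j m q \<in> borel_measurable borel"
    by (intro borel_measurable_continuous_onI continuous_on_choose_density)
  have f0: "0 \<le> f t" for t
    using choose_density_nonneg[OF pos] by (simp add: f_def indicator_def)
  have "(\<integral>\<^sup>+t. ennreal (f t) \<partial>lborel) = ennreal ?E"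
    unfolding nn_integral_binomial_empty_spaces[OF N j q pos]
    by (intro nn_integral_cong) (auto simp: f_def indicator_def)
  then have "has_bochner_integral lborel f ?E"
    using f0 E0 by (intro has_bochner_integral_nn_integral) (auto simp: f_def)
  then have int: "integrable lborel f" and eq: "integral\<^sup>L lborel f = ?E"
    by (auto simp: has_bochner_integral_iff)
  have "((\<lambda>R. \<integral>t. indicator {..R} t *\<^sub>R f t \<partial>lborel) \<longlongrightarrow> integral\<^sup>L lborel f) at_top"
    by (rule tendsto_integral_at_top) (auto intro: int)
  moreover have "(\<integral>t. indicator {..R} t *\<^sub>R f t \<partial>lborel) = integral {0..R} (choose_density N j m q)" for R
  proof -
    have "(\<integral>t. indicator {..R} t *\<^sub>R f t \<partial>lborel) = (LINT t:{0..R}|lborel. choose_density N j m q t)"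
      unfolding set_lebesgue_integral_def by (intro Bochner_Integration.integral_cong) (auto simp: f_def indicator_def)
    also have "\<dots> = integral {0..R} (choose_density N j m q)"
      by (intro set_borel_integral_eq_integral borel_integrable_atLeastAtMost' continuous_on_choose_density)
    finally show ?thesis .
  qed
  ultimately show ?thesis
    by (simp add: eq)
qed

section \<open>The derivative of the density along a line\<close>

definition poisson_point :: "nat \<Rightarrow> real \<Rightarrow> real" where
  "poisson_point n x = exp (- x) * x ^ n / fact n"

definition poisson_weight_deriv :: "nat \<Rightarrow> nat set \<Rightarrow> nat \<Rightarrow> real \<Rightarrow> real" where
  "poisson_weight_deriv j S k x = exp (- x) - (if k \<in> S then poisson_point (j - 1) x else 0)"

text \<open>
  The sum telescopes: raising the cut-off by one adds a Poisson probability, whose derivative is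
  the difference of two neighbouring Poisson probabilities.
\<close>

lemma DERIV_poisson_few: "(poisson_few (Suc n) has_field_derivative exp (- x) - poisson_point n x) (at x)"
proof (induction n)
  case 0
  have "poisson_few (Suc 0) = (\<lambda>x. 0)" by (simp add: poisson_few_def fun_eq_iff)
  then show ?case by (simp add: poisson_point_def)
next
  case (Suc n)
  have "poisson_few (Suc (Suc n)) = (\<lambda>x. poisson_few (Suc n) x + poisson_point (Suc n) x)"
    by (simp add: poisson_few_def poisson_point_def fun_eq_iff algebra_simps)
  moreover have d: "(poisson_point (Suc n) has_field_derivative poisson_point n x - poisson_point (Suc n) x) (at x)"
  proof -
    have "((\<lambda>x. exp (- x) * x ^ Suc n / fact (Suc n)) has_field_derivative
       (exp (- x) * (real (Suc n) * x ^ n) - exp (- x) * x ^ Suc n) / fact (Suc n)) (at x)"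
      by (auto intro!: derivative_eq_intros simp del: power_Suc fact_Suc of_nat_Suc)
    then show ?thesis
      by (simp add: poisson_point_def[abs_def] diff_divide_distrib del: of_nat_Suc power_Suc)
  qed
  ultimately show ?case
    using DERIV_add[OF Suc.IH d] by simp
qed

lemma DERIV_poisson_weight:
  assumes "1 \<le> j"
  shows "(poisson_weight j S k has_field_derivative poisson_weight_deriv j S k x) (at x)"
proof (cases "k \<in> S")
  case True
  then show ?thesis
    using DERIV_poisson_few[of "j - 1" x] assms
    by (simp add: poisson_weight_def[abs_def] poisson_weight_deriv_def)
next
  case False
  then show ?thesis
    unfolding poisson_weight_def[abs_def] poisson_weight_deriv_def
    by (auto intro!: derivative_eq_intros)
qed

lemma DERIV_poisson_weight_chain[derivative_intros]:
  assumes "1 \<le> j" "(f has_field_derivative D) (at x)"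
  shows "((\<lambda>x. poisson_weight j S k (f x)) has_field_derivative poisson_weight_deriv j S k (f x) * D) (at x)"
  using DERIV_chain2[OF DERIV_poisson_weight[OF assms(1)] assms(2)] .

lemma continuous_on_poisson_weight_deriv[continuous_intros]:
  fixes f :: "'a :: topological_space \<Rightarrow> real"
  shows "continuous_on A f \<Longrightarrow> continuous_on A (\<lambda>x. poisson_weight_deriv j S k (f x))"
  unfolding poisson_weight_deriv_def poisson_point_def
  by (cases "k \<in> S") (auto intro!: continuous_intros)

text \<open>
  With \<open>q\<close> moving in direction \<open>d\<close>, only the products \<open>q i * t\<close> matter, apart from the rate
  \<open>q i\<close> of the completing type, so that the change of the density is largely a displacement in
  time. The quantity \<open>flux\<close> is the density with each completing rate \<open>q i\<close> replaced by
  \<open>d i * t\<close>; its time derivative absorbs every derivative of the factor of the completing type.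
\<close>

definition flux :: "nat \<Rightarrow> nat \<Rightarrow> nat set \<Rightarrow> (nat \<Rightarrow> real) \<Rightarrow> (nat \<Rightarrow> real) \<Rightarrow> real \<Rightarrow> real" where
  "flux N j S q d t =
     (\<Sum>i\<in>{1..N}. d i * t * exp (- (q i * t)) * (\<Prod>k\<in>{1..N} - {i}. poisson_weight j S k (q k * t)))"

text \<open>
  What remains of the derivative in direction \<open>d\<close> once the time derivative of \<open>flux\<close> is split
  off. The coefficient vanishes if \<open>d\<close> is proportional to \<open>q\<close>, as it must: rescaling \<open>q\<close> is a
  rescaling of time.
\<close>

definition source :: "nat \<Rightarrow> nat \<Rightarrow> nat set \<Rightarrow> (nat \<Rightarrow> real) \<Rightarrow> (nat \<Rightarrow> real) \<Rightarrow> real \<Rightarrow> real" where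
  "source N j S q d t =
     (\<Sum>i\<in>{1..N}. \<Sum>k\<in>{1..N} - {i}. (q i * d k - q k * d i) * t * exp (- (q i * t)) *
        poisson_weight_deriv j S k (q k * t) *
        (\<Prod>l\<in>{1..N} - {i} - {k}. poisson_weight j S l (q l * t)))"

definition flux_deriv :: "nat \<Rightarrow> nat \<Rightarrow> nat set \<Rightarrow> (nat \<Rightarrow> real) \<Rightarrow> (nat \<Rightarrow> real) \<Rightarrow> real \<Rightarrow> real" where
  "flux_deriv N j S q d t =
     (\<Sum>i\<in>{1..N}. d i * (1 - q i * t) * exp (- (q i * t)) * (\<Prod>k\<in>{1..N} - {i}. poisson_weight j S k (q k * t))
       + d i * t * exp (- (q i * t)) * (\<Sum>k\<in>{1..N} - {i}. poisson_weight_deriv j S k (q k * t) * q k *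
           (\<Prod>l\<in>{1..N} - {i} - {k}. poisson_weight j S l (q l * t))))"

lemma DERIV_flux:
  assumes "1 \<le> j"
  shows "(flux N j S q d has_field_derivative flux_deriv N j S q d t) (at t)"
  unfolding flux_def[abs_def] flux_deriv_def
proof (rule DERIV_sum)
  fix i assume "i \<in> {1..N}"
  have P: "((\<lambda>t. \<Prod>k\<in>{1..N} - {i}. poisson_weight j S k (q k * t)) has_field_derivative
     (\<Sum>k\<in>{1..N} - {i}. poisson_weight_deriv j S k (q k * t) * q k *
           (\<Prod>l\<in>{1..N} - {i} - {k}. poisson_weight j S l (q l * t)))) (at t)"
    by (rule has_field_derivative_prod) (auto intro!: derivative_eq_intros assms)
  have E: "((\<lambda>t. d i * t * exp (- (q i * t))) has_field_derivative d i * (1 - q i * t) * exp (- (q i * t))) (at t)"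
    by (auto intro!: derivative_eq_intros simp: algebra_simps)
  show "((\<lambda>t. d i * t * exp (- (q i * t)) * (\<Prod>k\<in>{1..N} - {i}. poisson_weight j S k (q k * t))) has_field_derivative
     d i * (1 - q i * t) * exp (- (q i * t)) * (\<Prod>k\<in>{1..N} - {i}. poisson_weight j S k (q k * t))
       + d i * t * exp (- (q i * t)) * (\<Sum>k\<in>{1..N} - {i}. poisson_weight_deriv j S k (q k * t) * q k *
           (\<Prod>l\<in>{1..N} - {i} - {k}. poisson_weight j S l (q l * t)))) (at t)"
    using DERIV_mult[OF E P] by (simp add: algebra_simps)
qed

text \<open>
  A conservation law: the derivative in the direction \<open>d\<close> is a source term plus a time
  derivative, and the latter integrates to a boundary term.
\<close>

lemma DERIV_deficient_density_line:
  assumes "1 \<le> j" and Q: "\<And>k. Q \<theta> k = q k" "\<And>k. ((\<lambda>\<theta>. Q \<theta> k) has_field_derivative d k) (at \<theta>)"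
  shows "((\<lambda>\<theta>. deficient_density N j S (Q \<theta>) t) has_field_derivative
    source N j S q d t + flux_deriv N j S q d t) (at \<theta>)"
proof -
  let ?P = "\<lambda>i. \<Prod>k\<in>{1..N} - {i}. poisson_weight j S k (q k * t)"
  let ?D = "\<lambda>i k. poisson_weight_deriv j S k (q k * t) * (\<Prod>l\<in>{1..N} - {i} - {k}. poisson_weight j S l (q l * t))"
  have "((\<lambda>\<theta>. deficient_density N j S (Q \<theta>) t) has_field_derivative
     (\<Sum>i\<in>{1..N}. d i * (1 - q i * t) * exp (- (q i * t)) * ?P i
       + q i * exp (- (q i * t)) * (\<Sum>k\<in>{1..N} - {i}. d k * t * ?D i k))) (at \<theta>)"
    unfolding deficient_density_def
  proof (rule DERIV_sum)
    fix i assume "i \<in> {1..N}"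
    have P: "((\<lambda>\<theta>. \<Prod>k\<in>{1..N} - {i}. poisson_weight j S k (Q \<theta> k * t)) has_field_derivative
       (\<Sum>k\<in>{1..N} - {i}. poisson_weight_deriv j S k (Q \<theta> k * t) * (d k * t) *
             (\<Prod>l\<in>{1..N} - {i} - {k}. poisson_weight j S l (Q \<theta> l * t)))) (at \<theta>)"
      by (rule has_field_derivative_prod) (auto intro!: derivative_eq_intros Q(2) assms(1))
    have E: "((\<lambda>\<theta>. Q \<theta> i * exp (- (Q \<theta> i * t))) has_field_derivative d i * (1 - q i * t) * exp (- (q i * t))) (at \<theta>)"
      by (auto intro!: derivative_eq_intros Q(2) simp: algebra_simps Q(1))
    show "((\<lambda>\<theta>. Q \<theta> i * exp (- (Q \<theta> i * t)) * (\<Prod>k\<in>{1..N} - {i}. poisson_weight j S k (Q \<theta> k * t))) has_field_derivative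
       d i * (1 - q i * t) * exp (- (q i * t)) * ?P i
       + q i * exp (- (q i * t)) * (\<Sum>k\<in>{1..N} - {i}. d k * t * ?D i k)) (at \<theta>)"
      using DERIV_mult[OF E P] by (simp add: Q(1) algebra_simps)
  qed
  also have "(\<Sum>i\<in>{1..N}. d i * (1 - q i * t) * exp (- (q i * t)) * ?P i
       + q i * exp (- (q i * t)) * (\<Sum>k\<in>{1..N} - {i}. d k * t * ?D i k)) = source N j S q d t + flux_deriv N j S q d t"
    unfolding source_def flux_deriv_def sum.distrib[symmetric]
    by (intro sum.cong refl)
       (simp add: sum_distrib_left sum.distrib[symmetric] algebra_simps sum_subtractf[symmetric])
  finally show ?thesis .
qed

section \<open>The sign of the source\<close>

lemma sum_offdiag_swap:
  fixes F :: "'a \<Rightarrow> 'a \<Rightarrow> 'b :: comm_monoid_add"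
  assumes "finite I"
  shows "(\<Sum>i\<in>I. \<Sum>k\<in>I - {i}. F i k) = (\<Sum>i\<in>I. \<Sum>k\<in>I - {i}. F k i)"
proof -
  have "(\<Sum>i\<in>I. \<Sum>k\<in>I - {i}. F i k) = (\<Sum>(i, k)\<in>(SIGMA i:I. I - {i}). F i k)"
    using assms by (subst sum.Sigma) auto
  also have "\<dots> = (\<Sum>(i, k)\<in>(SIGMA i:I. I - {i}). F k i)"
    by (rule sum.reindex_bij_witness[of _ prod.swap prod.swap]) auto
  also have "\<dots> = (\<Sum>i\<in>I. \<Sum>k\<in>I - {i}. F k i)"
    using assms by (subst sum.Sigma) auto
  finally show ?thesis .
qed

definition pair_weight :: "nat \<Rightarrow> nat \<Rightarrow> nat \<Rightarrow> (nat \<Rightarrow> real) \<Rightarrow> nat \<Rightarrow> nat \<Rightarrow> real" where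
  "pair_weight N j m x i k =
     (\<Sum>S | S \<subseteq> {1..N} \<and> card S = m. if k \<in> S then (\<Prod>l\<in>{1..N} - {i} - {k}. poisson_weight j S l (x l)) else 0)"

text \<open>
  Exchanging \<open>i\<close> and \<open>k\<close> in \<open>S\<close> is a bijection from the sets containing \<open>k\<close> to those containing
  \<open>i\<close>, and it does not affect the other types. For a single set \<open>S\<close> this symmetry fails, which
  is why all sets of a given size are treated together.
\<close>

lemma pair_weight_commute:
  assumes "i \<in> {1..N}" "k \<in> {1..N}"
  shows "pair_weight N j m x i k = pair_weight N j m x k i"
proof -
  let ?\<tau> = "Transposition.transpose i k"
  let ?Sub = "{S. S \<subseteq> {1..N} \<and> card S = m}"
  have inv: "?\<tau> ` ?\<tau> ` S = S" for S
    by (simp add: image_comp)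
  have closed: "?\<tau> ` S \<in> ?Sub" if "S \<in> ?Sub" for S
  proof -
    have "?\<tau> ` S \<subseteq> {1..N}"
      using that assms by (auto simp: Transposition.transpose_def)
    then show ?thesis
      using that by (simp add: card_image)
  qed
  have mem: "l \<in> ?\<tau> ` S \<longleftrightarrow> ?\<tau> l \<in> S" for l S
    by (metis image_iff transpose_involutory)
  have "(if i \<in> ?\<tau> ` S then \<Prod>l\<in>{1..N} - {k} - {i}. poisson_weight j (?\<tau> ` S) l (x l) else 0) =
     (if k \<in> S then \<Prod>l\<in>{1..N} - {i} - {k}. poisson_weight j S l (x l) else 0)" for S
  proof -
    have "(\<Prod>l\<in>{1..N} - {k} - {i}. poisson_weight j (?\<tau> ` S) l (x l)) = (\<Prod>l\<in>{1..N} - {i} - {k}. poisson_weight j S l (x l))"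
      by (rule prod.cong) (auto simp: poisson_weight_def mem)
    then show ?thesis
      by (simp add: mem)
  qed
  then show ?thesis
    unfolding pair_weight_def
    by (intro sum.reindex_bij_witness[of _ "(`) ?\<tau>" "(`) ?\<tau>"] inv closed)
qed

lemma pair_weight_nonneg:
  assumes "\<And>l. l \<in> {1..N} \<Longrightarrow> 0 \<le> x l"
  shows "0 \<le> pair_weight N j m x i k"
  unfolding pair_weight_def
  using assms by (intro sum_nonneg) (auto intro!: prod_nonneg poisson_weight_nonneg)

lemma poisson_weight_pos:
  assumes "2 \<le> j" "0 < x"
  shows "0 < poisson_weight j S k x"
proof -
  have "0 < (\<Sum>c\<in>{1..<j}. x ^ c / fact c)"
    using assms by (intro sum_pos) auto
  then show ?thesis
    using assms by (auto simp: poisson_weight_def poisson_few_def)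
qed

lemma pair_weight_pos:
  assumes "\<And>l. l \<in> {1..N} \<Longrightarrow> 0 < x l" and m: "1 \<le> m" "m \<le> N" and k: "k \<in> {1..N}" and j: "2 \<le> j"
  shows "0 < pair_weight N j m x i k"
proof -
  have "m - 1 \<le> card ({1..N} - {k})" using m k by simp
  then obtain T where T: "T \<subseteq> {1..N} - {k}" "card T = m - 1"
    by (meson obtain_subset_with_card_n)
  have "finite T" using T(1) by (auto intro: finite_subset)
  then have S: "insert k T \<subseteq> {1..N}" "card (insert k T) = m"
    using T k m by (auto simp: card_insert_if)
  show ?thesis
    unfolding pair_weight_def
  proof (rule sum_pos2)
    show "insert k T \<in> {S. S \<subseteq> {1..N} \<and> card S = m}" using S by simp
    show "0 < (if k \<in> insert k T then \<Prod>l\<in>{1..N} - {i} - {k}. poisson_weight j (insert k T) l (x l) else 0)"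
    proof -
      have "0 < (\<Prod>l\<in>{1..N} - {i} - {k}. poisson_weight j (insert k T) l (x l))"
        by (intro prod_pos ballI poisson_weight_pos assms(1) j) auto
      then show ?thesis by simp
    qed
    show "0 \<le> (if k \<in> S then \<Prod>l\<in>{1..N} - {i} - {k}. poisson_weight j S l (x l) else 0)" for S
      using assms(1) by (auto intro!: prod_nonneg poisson_weight_nonneg simp: less_imp_le)
  qed simp
qed

text \<open>
  The derivative of a Poisson weight is \<open>exp (- x)\<close>, minus \<open>poisson_point (j - 1) x\<close> for types
  in \<open>S\<close>. The products of two exponentials are symmetric in \<open>i\<close> and \<open>k\<close>, while \<open>q k - q i\<close> is
  antisymmetric; so they cancel for each \<open>S\<close>. The remaining part has a symmetric weight after
  summation over \<open>S\<close>, and averaging it with its copy in which \<open>i\<close> and \<open>k\<close> are exchanged gives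
  the formula; the factor \<open>2\<close> comes from there. The hypothesis holds on a line through the
  uniform vector, away from that vector itself.
\<close>

lemma sum_source_eq:
  fixes N j m :: nat and q d :: "nat \<Rightarrow> real" and t c :: real
  assumes qd: "\<And>i k. q i * d k - q k * d i = c * (q k - q i)"
  shows "2 * (\<Sum>S | S \<subseteq> {1..N} \<and> card S = m. source N j S q d t) =
    - (c * t * (\<Sum>i\<in>{1..N}. \<Sum>k\<in>{1..N} - {i}. (q k - q i) *
       (exp (- (q i * t)) * poisson_point (j - 1) (q k * t) - exp (- (q k * t)) * poisson_point (j - 1) (q i * t)) *
       pair_weight N j m (\<lambda>l. q l * t) i k))"
proof -
  let ?Sub = "{S. S \<subseteq> {1..N} \<and> card S = m}"
  define e where "e = (\<lambda>i. exp (- (q i * t)))"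
  define g where "g = (\<lambda>k. poisson_point (j - 1) (q k * t))"
  define P where "P = (\<lambda>S i k. \<Prod>l\<in>{1..N} - {i} - {k}. poisson_weight j S l (q l * t))"
  define W where "W = pair_weight N j m (\<lambda>l. q l * t)"
  have folds: "exp (- (q i * t)) = e i" "poisson_point (j - 1) (q k * t) = g k"
    "(\<Prod>l\<in>{1..N} - {i} - {k}. poisson_weight j S l (q l * t)) = P S i k" for S i k
    by (simp_all add: e_def g_def P_def)
  have P_commute: "P S i k = P S k i" for S i k
    unfolding P_def by (simp add: Diff_insert2[symmetric] insert_commute)
  have cancel: "(\<Sum>i\<in>{1..N}. \<Sum>k\<in>{1..N} - {i}. (q k - q i) * (e i * e k) * P S i k) = 0" for S
  proof -
    have "(\<Sum>i\<in>{1..N}. \<Sum>k\<in>{1..N} - {i}. (q k - q i) * (e i * e k) * P S i k)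
       = (\<Sum>i\<in>{1..N}. \<Sum>k\<in>{1..N} - {i}. (q i - q k) * (e k * e i) * P S k i)"
      by (rule sum_offdiag_swap) simp
    also have "\<dots> = - (\<Sum>i\<in>{1..N}. \<Sum>k\<in>{1..N} - {i}. (q k - q i) * (e i * e k) * P S i k)"
      by (simp add: sum_negf[symmetric] P_commute[of S] algebra_simps)
    finally show ?thesis by simp
  qed
  have src: "source N j S q d t = - (c * t * (\<Sum>i\<in>{1..N}. \<Sum>k\<in>{1..N} - {i}. (q k - q i) * (e i * g k) * (if k \<in> S then P S i k else 0)))" for S
  proof -
    have "source N j S q d t = c * t * (\<Sum>i\<in>{1..N}. \<Sum>k\<in>{1..N} - {i}. (q k - q i) * (e i * e k) * P S i k)
      - c * t * (\<Sum>i\<in>{1..N}. \<Sum>k\<in>{1..N} - {i}. (q k - q i) * (e i * g k) * (if k \<in> S then P S i k else 0))"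
      unfolding source_def qd poisson_weight_deriv_def folds sum_distrib_left sum_subtractf[symmetric]
      by (intro sum.cong refl) (simp add: algebra_simps)
    then show ?thesis unfolding cancel by simp
  qed
  have W: "(\<Sum>S\<in>?Sub. if k \<in> S then P S i k else 0) = W i k" for i k
    unfolding W_def P_def pair_weight_def by (rule refl)
  have "(\<Sum>S\<in>?Sub. source N j S q d t) =
     - (c * t * (\<Sum>S\<in>?Sub. \<Sum>i\<in>{1..N}. \<Sum>k\<in>{1..N} - {i}. (q k - q i) * (e i * g k) * (if k \<in> S then P S i k else 0)))"
    unfolding src sum_negf sum_distrib_left ..
  also have "(\<Sum>S\<in>?Sub. \<Sum>i\<in>{1..N}. \<Sum>k\<in>{1..N} - {i}. (q k - q i) * (e i * g k) * (if k \<in> S then P S i k else 0))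
     = (\<Sum>i\<in>{1..N}. \<Sum>k\<in>{1..N} - {i}. \<Sum>S\<in>?Sub. (q k - q i) * (e i * g k) * (if k \<in> S then P S i k else 0))"
    by (subst sum.swap) (intro sum.cong refl sum.swap)
  also have "\<dots> = (\<Sum>i\<in>{1..N}. \<Sum>k\<in>{1..N} - {i}. (q k - q i) * (e i * g k) * W i k)"
    unfolding W[symmetric] sum_distrib_left ..
  finally have once: "(\<Sum>S\<in>?Sub. source N j S q d t) =
     - (c * t * (\<Sum>i\<in>{1..N}. \<Sum>k\<in>{1..N} - {i}. (q k - q i) * (e i * g k) * W i k))" .
  have "(\<Sum>i\<in>{1..N}. \<Sum>k\<in>{1..N} - {i}. (q k - q i) * (e i * g k) * W i k)
     = (\<Sum>i\<in>{1..N}. \<Sum>k\<in>{1..N} - {i}. (q i - q k) * (e k * g i) * W k i)"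
    by (rule sum_offdiag_swap) simp
  also have "\<dots> = (\<Sum>i\<in>{1..N}. \<Sum>k\<in>{1..N} - {i}. (q i - q k) * (e k * g i) * W i k)"
    unfolding W_def by (intro sum.cong refl) (simp add: pair_weight_commute)
  finally have swapped: "2 * (\<Sum>i\<in>{1..N}. \<Sum>k\<in>{1..N} - {i}. (q k - q i) * (e i * g k) * W i k)
     = (\<Sum>i\<in>{1..N}. \<Sum>k\<in>{1..N} - {i}. (q k - q i) * (e i * g k) * W i k)
       + (\<Sum>i\<in>{1..N}. \<Sum>k\<in>{1..N} - {i}. (q i - q k) * (e k * g i) * W i k)"
    by simp
  have "2 * (\<Sum>S\<in>?Sub. source N j S q d t)
     = - (c * t * (2 * (\<Sum>i\<in>{1..N}. \<Sum>k\<in>{1..N} - {i}. (q k - q i) * (e i * g k) * W i k)))"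
    unfolding once by simp
  also have "\<dots> = - (c * t * (\<Sum>i\<in>{1..N}. \<Sum>k\<in>{1..N} - {i}. (q k - q i) * (e i * g k - e k * g i) * W i k))"
    unfolding swapped sum.distrib[symmetric] by (simp add: algebra_simps)
  finally show ?thesis
    unfolding e_def g_def W_def .
qed

text \<open>
  The ratio of \<open>poisson_point n x\<close> to \<open>exp (- x)\<close> is \<open>x ^ n / n!\<close>, which increases with \<open>x\<close>; the
  second factor therefore has the sign of the first.
\<close>

lemma pair_gain_nonneg:
  fixes x y :: real
  assumes "0 \<le> x" "0 \<le> y"
  shows "0 \<le> (y - x) * (exp (- x) * poisson_point n y - exp (- y) * poisson_point n x)"
proof -
  have "(y - x) * (exp (- x) * poisson_point n y - exp (- y) * poisson_point n x)
     = exp (- x) * exp (- y) / fact n * ((y - x) * (y ^ n - x ^ n))"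
    by (simp add: poisson_point_def field_simps)
  moreover have "0 \<le> (y - x) * (y ^ n - x ^ n)"
    using assms by (cases "x \<le> y") (simp_all add: mult_nonneg_nonneg mult_nonpos_nonpos power_mono)
  ultimately show ?thesis by simp
qed

lemma pair_gain_pos:
  fixes x y :: real
  assumes "0 \<le> x" "0 \<le> y" "x \<noteq> y" "0 < n"
  shows "0 < (y - x) * (exp (- x) * poisson_point n y - exp (- y) * poisson_point n x)"
proof -
  have "(y - x) * (exp (- x) * poisson_point n y - exp (- y) * poisson_point n x)
     = exp (- x) * exp (- y) / fact n * ((y - x) * (y ^ n - x ^ n))"
    by (simp add: poisson_point_def field_simps)
  moreover have "0 < (y - x) * (y ^ n - x ^ n)"
    using assms by (cases "x < y") (simp_all add: mult_pos_pos mult_neg_neg power_strict_mono)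
  ultimately show ?thesis by simp
qed

lemma sum_source_nonpos:
  assumes qd: "\<And>i k. q i * d k - q k * d i = c * (q k - q i)" and "0 \<le> c" "0 \<le> t"
    and pos: "\<And>i. i \<in> {1..N} \<Longrightarrow> 0 < q i"
  shows "(\<Sum>S | S \<subseteq> {1..N} \<and> card S = m. source N j S q d t) \<le> 0"
proof (cases "t = 0")
  case True
  then show ?thesis by (simp add: source_def)
next
  case False
  with \<open>0 \<le> t\<close> have t: "0 < t" by simp
  have "0 \<le> (\<Sum>i\<in>{1..N}. \<Sum>k\<in>{1..N} - {i}. (q k - q i) *
       (exp (- (q i * t)) * poisson_point (j - 1) (q k * t) - exp (- (q k * t)) * poisson_point (j - 1) (q i * t)) *
       pair_weight N j m (\<lambda>l. q l * t) i k)" (is "0 \<le> (\<Sum>i\<in>_. \<Sum>k\<in>_. ?F i k * _)")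
  proof (intro sum_nonneg)
    fix i k assume ik: "i \<in> {1..N}" "k \<in> {1..N} - {i}"
    have "0 \<le> (q k * t - q i * t) *
       (exp (- (q i * t)) * poisson_point (j - 1) (q k * t) - exp (- (q k * t)) * poisson_point (j - 1) (q i * t))"
      using ik t by (intro pair_gain_nonneg mult_nonneg_nonneg) (auto intro!: less_imp_le[OF pos])
    also have "\<dots> = t * ?F i k" by (simp add: algebra_simps)
    finally have "0 \<le> ?F i k" using t by (simp add: zero_le_mult_iff)
    moreover have "0 \<le> pair_weight N j m (\<lambda>l. q l * t) i k"
      using pos t by (intro pair_weight_nonneg) (simp add: less_imp_le)
    ultimately show "0 \<le> ?F i k * pair_weight N j m (\<lambda>l. q l * t) i k"
      by (rule mult_nonneg_nonneg)
  qed
  with \<open>0 \<le> c\<close> t have "2 * (\<Sum>S | S \<subseteq> {1..N} \<and> card S = m. source N j S q d t) \<le> 0"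
    unfolding sum_source_eq[OF qd] by (simp add: mult_nonneg_nonneg)
  then show ?thesis by simp
qed

lemma sum_source_neg:
  assumes qd: "\<And>i k. q i * d k - q k * d i = c * (q k - q i)" and "0 < c" and t: "0 < t"
    and pos: "\<And>i. i \<in> {1..N} \<Longrightarrow> 0 < q i"
    and j: "2 \<le> j" and m: "1 \<le> m" "m \<le> N"
    and ab: "a \<in> {1..N}" "b \<in> {1..N}" "q a \<noteq> q b"
  shows "(\<Sum>S | S \<subseteq> {1..N} \<and> card S = m. source N j S q d t) < 0"
proof -
  define F where "F = (\<lambda>i k. (q k - q i) *
       (exp (- (q i * t)) * poisson_point (j - 1) (q k * t) - exp (- (q k * t)) * poisson_point (j - 1) (q i * t)) *
       pair_weight N j m (\<lambda>l. q l * t) i k)"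
  have F_eq: "t * F i k = (q k * t - q i * t) *
       (exp (- (q i * t)) * poisson_point (j - 1) (q k * t) - exp (- (q k * t)) * poisson_point (j - 1) (q i * t)) *
       pair_weight N j m (\<lambda>l. q l * t) i k" for i k
    by (simp add: F_def algebra_simps)
  have w: "0 < pair_weight N j m (\<lambda>l. q l * t) i k" if "k \<in> {1..N}" for i k
    using pos t m j that by (intro pair_weight_pos) auto
  have F0: "0 \<le> F i k" if "i \<in> {1..N}" "k \<in> {1..N}" for i k
  proof -
    have "0 \<le> t * F i k"
      unfolding F_eq using t that
      by (intro mult_nonneg_nonneg[OF pair_gain_nonneg] less_imp_le[OF w] mult_nonneg_nonneg less_imp_le[OF pos] less_imp_le[OF t])
    then show ?thesis using t by (simp add: zero_le_mult_iff)
  qed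
  have "0 < t * F a b"
    unfolding F_eq using t ab j
    by (intro mult_pos_pos[OF pair_gain_pos] w mult_nonneg_nonneg less_imp_le[OF pos] less_imp_le[OF t]) auto
  then have Fab: "0 < F a b" using t by (simp add: zero_less_mult_iff)
  have "0 < (\<Sum>i\<in>{1..N}. \<Sum>k\<in>{1..N} - {i}. F i k)"
  proof (rule sum_pos2[where i = a])
    show "0 < (\<Sum>k\<in>{1..N} - {a}. F a k)"
      by (rule sum_pos2[where i = b]) (use ab F0 Fab in auto)
    show "0 \<le> (\<Sum>k\<in>{1..N} - {i}. F i k)" if "i \<in> {1..N}" for i
      by (intro sum_nonneg F0 that) auto
  qed (use ab in auto)
  then have "0 < c * t * (\<Sum>i\<in>{1..N}. \<Sum>k\<in>{1..N} - {i}. F i k)"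
    using \<open>0 < c\<close> t by simp
  then have "2 * (\<Sum>S | S \<subseteq> {1..N} \<and> card S = m. source N j S q d t) < 0"
    unfolding sum_source_eq[OF qd] F_def by simp
  then show ?thesis by simp
qed

section \<open>Integration over time\<close>

lemma poisson_few_le_1:
  assumes "0 \<le> x"
  shows "poisson_few j x \<le> 1"
proof -
  have "(\<Sum>c\<in>{1..<j}. x ^ c / fact c) \<le> (\<Sum>c. x ^ c / fact c)"
    using assms exp_converges[of x]
    by (intro sum_le_suminf) (auto simp: field_simps sums_iff)
  also have "\<dots> = exp x"
    using exp_converges[of x] by (simp add: field_simps sums_iff)
  finally have "exp (- x) * (\<Sum>c\<in>{1..<j}. x ^ c / fact c) \<le> exp (- x) * exp x"
    by (intro mult_left_mono) auto
  then show ?thesis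
    by (simp add: poisson_few_def exp_minus)
qed

text \<open>
  The bound tends to \<open>0\<close> as \<open>t\<close> grows and depends on \<open>q\<close> only through a lower bound \<open>c\<close> for its
  entries; so the boundary term vanishes in the limit, uniformly on a segment of probability
  vectors.
\<close>

lemma abs_flux_le:
  assumes q: "\<And>i. i \<in> {1..N} \<Longrightarrow> c \<le> q i" and "0 < c" "0 \<le> t"
  shows "\<bar>flux N j S q d t\<bar> \<le> (\<Sum>i\<in>{1..N}. \<bar>d i\<bar>) * (t * exp (- (c * t)))"
proof -
  have q0: "0 \<le> q i * t" if "i \<in> {1..N}" for i
    using q[OF that] assms by simp
  have "\<bar>d i * t * exp (- (q i * t)) * (\<Prod>k\<in>{1..N} - {i}. poisson_weight j S k (q k * t))\<bar>
     \<le> \<bar>d i\<bar> * (t * exp (- (c * t)))" if i: "i \<in> {1..N}" for i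
  proof -
    have w: "0 \<le> poisson_weight j S k (q k * t)" "poisson_weight j S k (q k * t) \<le> 1"
      if "k \<in> {1..N} - {i}" for k
      using q0[of k] that by (auto simp: poisson_weight_nonneg) (simp add: poisson_weight_def poisson_few_le_1)
    have "exp (- (q i * t)) * (\<Prod>k\<in>{1..N} - {i}. poisson_weight j S k (q k * t)) \<le> exp (- (c * t)) * 1"
      using q[OF i] \<open>0 \<le> t\<close> w
      by (intro mult_mono prod_le_1 prod_nonneg) (auto intro!: mult_right_mono simp del: atLeastAtMost_iff)
    moreover have "0 \<le> (\<Prod>k\<in>{1..N} - {i}. poisson_weight j S k (q k * t))"
      using w by (intro prod_nonneg) blast
    ultimately show ?thesis
      using \<open>0 \<le> t\<close> by (simp add: abs_mult mult.assoc mult_left_mono)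
  qed
  then have "\<bar>flux N j S q d t\<bar> \<le> (\<Sum>i\<in>{1..N}. \<bar>d i\<bar> * (t * exp (- (c * t))))"
    unfolding flux_def by (intro order_trans[OF sum_abs] sum_mono)
  then show ?thesis
    by (simp add: sum_distrib_right)
qed

lemma segment_vector_lower_bound:
  assumes "1 \<le> N" and pos: "\<forall>i\<in>{1..N}. 0 < p i"
  obtains c where "0 < c" "\<And>\<theta> i. \<theta> \<in> {0..1} \<Longrightarrow> i \<in> {1..N} \<Longrightarrow> c \<le> segment_vector N p \<theta> i"
proof
  let ?c = "Min ((\<lambda>i. min (p i) (1 / real N)) ` {1..N})"
  show "0 < ?c"
    using assms by (subst Min_gr_iff) auto
  fix \<theta> :: real and i assume \<theta>: "\<theta> \<in> {0..1}" and i: "i \<in> {1..N}"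
  have "?c \<le> min (p i) (1 / real N)"
    using i by (intro Min_le) auto
  then have "(1 - \<theta>) * ?c + \<theta> * ?c \<le> (1 - \<theta>) * (1 / real N) + \<theta> * p i"
    using \<theta> by (intro add_mono mult_left_mono) auto
  moreover have "(1 - \<theta>) * ?c + \<theta> * ?c = ?c"
    by (simp only: distrib_right[symmetric]) simp
  moreover have "segment_vector N p \<theta> i = (1 - \<theta>) * (1 / real N) + \<theta> * p i"
    by (simp add: segment_vector_def uniform_vector_def algebra_simps diff_divide_distrib)
  ultimately show "?c \<le> segment_vector N p \<theta> i"
    by linarith
qed

text \<open>
  Leibniz's rule on a bounded time interval; the time derivative of the flux integrates to its
  value at \<open>R\<close>, since the flux is \<open>0\<close> at time \<open>0\<close>.
\<close>

lemma DERIV_integral_choose_density: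
  fixes N :: nat and p :: "nat \<Rightarrow> real"
  assumes "1 \<le> j" "0 \<le> R"
  defines "q \<equiv> segment_vector N p" and "d \<equiv> (\<lambda>i. p i - uniform_vector N i)"
  shows "((\<lambda>\<theta>. integral {0..R} (choose_density N j m (q \<theta>))) has_field_derivative
    integral {0..R} (\<lambda>t. \<Sum>S | S \<subseteq> {1..N} \<and> card S = m. source N j S (q \<theta>) d t)
      + (\<Sum>S | S \<subseteq> {1..N} \<and> card S = m. flux N j S (q \<theta>) d R)) (at \<theta>)"
proof -
  let ?Sub = "{S. S \<subseteq> {1..N} \<and> card S = m}"
  let ?A = "\<lambda>\<theta> t. \<Sum>S\<in>?Sub. source N j S (q \<theta>) d t"
  let ?C = "\<lambda>\<theta> t. \<Sum>S\<in>?Sub. flux_deriv N j S (q \<theta>) d t"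
  have contA: "continuous_on X (\<lambda>x. ?A (f x) (g x))" if "continuous_on X f" "continuous_on X g"
    for X :: "'z :: topological_space set" and f g
    unfolding source_def q_def segment_vector_def d_def by (intro continuous_intros that)
  have contC: "continuous_on X (\<lambda>x. ?C (f x) (g x))" if "continuous_on X f" "continuous_on X g"
    for X :: "'z :: topological_space set" and f g
    unfolding flux_deriv_def q_def segment_vector_def d_def by (intro continuous_intros that)
  have "((\<lambda>\<theta>. integral (cbox 0 R) (choose_density N j m (q \<theta>))) has_field_derivative
     integral (cbox 0 R) (\<lambda>t. ?A \<theta> t + ?C \<theta> t)) (at \<theta> within UNIV)"
  proof (rule leibniz_rule_field_derivative)
    fix \<theta> t :: real
    have "((\<lambda>\<theta>. choose_density N j m (q \<theta>) t) has_field_derivative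
        (\<Sum>S\<in>?Sub. source N j S (q \<theta>) d t + flux_deriv N j S (q \<theta>) d t)) (at \<theta>)"
      unfolding choose_density_def
      by (intro DERIV_sum DERIV_deficient_density_line assms)
         (auto simp: q_def d_def segment_vector_def intro!: derivative_eq_intros)
    then show "((\<lambda>\<theta>. choose_density N j m (q \<theta>) t) has_field_derivative ?A \<theta> t + ?C \<theta> t) (at \<theta> within UNIV)"
      by (simp add: sum.distrib)
  next
    fix \<theta>
    show "choose_density N j m (q \<theta>) integrable_on cbox 0 R"
      by (intro integrable_continuous continuous_on_choose_density)
  next
    show "continuous_on (UNIV \<times> cbox 0 R) (\<lambda>(\<theta>, t). ?A \<theta> t + ?C \<theta> t)"
      unfolding split_beta by (intro continuous_on_add contA contC continuous_intros)
  qed auto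
  moreover have "integral {0..R} (\<lambda>t. ?A \<theta> t + ?C \<theta> t) = integral {0..R} (?A \<theta>) + integral {0..R} (?C \<theta>)"
    by (intro integral_add integrable_continuous_real contA contC continuous_intros)
  moreover have "integral {0..R} (?C \<theta>) = (\<Sum>S\<in>?Sub. flux N j S (q \<theta>) d R)"
  proof -
    have D: "((\<lambda>t. \<Sum>S\<in>?Sub. flux N j S (q \<theta>) d t) has_vector_derivative ?C \<theta> t) (at t within {0..R})" for t
      unfolding has_real_derivative_iff_has_vector_derivative[symmetric]
      by (rule has_field_derivative_at_within, rule DERIV_sum, rule DERIV_flux[OF \<open>1 \<le> j\<close>])
    have "(?C \<theta> has_integral (\<Sum>S\<in>?Sub. flux N j S (q \<theta>) d R) - (\<Sum>S\<in>?Sub. flux N j S (q \<theta>) d 0)) {0..R}"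
      by (rule fundamental_theorem_of_calculus[OF \<open>0 \<le> R\<close>]) (rule D)
    then show ?thesis
      by (simp add: flux_def integral_unique)
  qed
  ultimately show ?thesis
    by (simp add: cbox_interval)
qed

section \<open>Monotonicity along the segment\<close>

definition total_source :: "nat \<Rightarrow> nat \<Rightarrow> nat \<Rightarrow> (nat \<Rightarrow> real) \<Rightarrow> real \<Rightarrow> real \<Rightarrow> real" where
  "total_source N j m p \<theta> t = (\<Sum>S | S \<subseteq> {1..N} \<and> card S = m.
     source N j S (segment_vector N p \<theta>) (\<lambda>i. p i - uniform_vector N i) t)"

lemma continuous_on_total_source:
  "continuous_on X f \<Longrightarrow> continuous_on X g \<Longrightarrow> continuous_on X (\<lambda>x. total_source N j m p (f x) (g x))"
  unfolding total_source_def source_def segment_vector_def by (intro continuous_intros)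

text \<open>
  Both sides equal \<open>(p k - p i) / N\<close>, because the starting point of the segment has equal
  entries. The sign of the source rests on this identity.
\<close>

lemma segment_vector_cross:
  assumes "\<theta> \<noteq> 0"
  shows "segment_vector N p \<theta> i * (p k - uniform_vector N k) - segment_vector N p \<theta> k * (p i - uniform_vector N i)
    = 1 / (real N * \<theta>) * (segment_vector N p \<theta> k - segment_vector N p \<theta> i)"
proof -
  have "segment_vector N p \<theta> k - segment_vector N p \<theta> i = \<theta> * (p k - p i)"
    by (simp add: segment_vector_def uniform_vector_def algebra_simps)
  then have "1 / (real N * \<theta>) * (segment_vector N p \<theta> k - segment_vector N p \<theta> i) = 1 / real N * (p k - p i)"
    using assms by simp
  then show ?thesis
    by (simp add: segment_vector_def uniform_vector_def algebra_simps)
qed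

lemma segment_vector_pos:
  assumes "1 \<le> N" "\<forall>i\<in>{1..N}. 0 < p i" "\<theta> \<in> {0..1}" "i \<in> {1..N}"
  shows "0 < segment_vector N p \<theta> i"
  by (rule segment_vector_lower_bound[OF assms(1,2)]) (use assms(3,4) in force)

lemma total_source_nonpos:
  assumes "1 \<le> N" "\<forall>i\<in>{1..N}. 0 < p i" "0 < \<theta>" "\<theta> \<le> 1" "0 \<le> t"
  shows "total_source N j m p \<theta> t \<le> 0"
  unfolding total_source_def
  by (rule sum_source_nonpos[OF segment_vector_cross]) (use assms segment_vector_pos[OF assms(1,2)] in auto)

lemma total_source_neg:
  assumes "1 \<le> N" "2 \<le> j" "1 \<le> m" "m \<le> N" "\<forall>i\<in>{1..N}. 0 < p i" "0 < \<theta>" "\<theta> \<le> 1" "0 < t"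
    and ab: "a \<in> {1..N}" "b \<in> {1..N}" "p a \<noteq> p b"
  shows "total_source N j m p \<theta> t < 0"
proof -
  have "segment_vector N p \<theta> a \<noteq> segment_vector N p \<theta> b"
    using ab(3) \<open>0 < \<theta>\<close> by (simp add: segment_vector_def uniform_vector_def)
  then show ?thesis
    unfolding total_source_def
    by (intro sum_source_neg[OF segment_vector_cross _ _ _ _ _ _ ab(1,2)])
       (use assms segment_vector_pos[OF assms(1,5)] in auto)
qed

lemma tendsto_mult_exp_neg:
  fixes c :: real
  assumes "0 < c"
  shows "((\<lambda>R. R * exp (- (c * R))) \<longlongrightarrow> 0) at_top"
proof -
  have "filterlim (\<lambda>R. c * R) at_top at_top"
    using assms by (rule filterlim_tendsto_pos_mult_at_top[OF tendsto_const]) (rule filterlim_ident)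
  from filterlim_compose[OF tendsto_power_div_exp_0[of 1] this]
  have "((\<lambda>R. 1 / c * ((c * R) ^ 1 / exp (c * R))) \<longlongrightarrow> 1 / c * 0) at_top"
    by (rule tendsto_mult_left)
  then show ?thesis
    using assms by (simp add: exp_minus field_simps)
qed

definition choose_expectation :: "nat \<Rightarrow> nat \<Rightarrow> nat \<Rightarrow> (nat \<Rightarrow> real) \<Rightarrow> real" where
  "choose_expectation N j m q = coupon_expectation N q (\<lambda>\<omega>. real (empty_spaces N j \<omega> choose m))"

text \<open>
  The mean value theorem is applied on a bounded time interval \<open>{0..R}\<close>, where differentiation
  under the integral is elementary; the limit \<open>R \<rightarrow> \<infinity>\<close> is taken in the resulting inequality.
\<close>

lemma choose_expectation_increment_le:
  assumes N: "1 \<le> N" and j: "2 \<le> j" and p: "is_prob_vector N p" and pos: "\<forall>i\<in>{1..N}. 0 < p i"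
    and ab: "0 \<le> a" "a < b" "b \<le> 1"
    and \<delta>: "\<And>\<theta> R. a < \<theta> \<Longrightarrow> \<theta> < b \<Longrightarrow> 2 \<le> R \<Longrightarrow> integral {0..R} (total_source N j m p \<theta>) \<le> - \<delta>"
  shows "choose_expectation N j m (segment_vector N p b) - choose_expectation N j m (segment_vector N p a)
    \<le> (b - a) * - \<delta>"
proof -
  obtain c where c: "0 < c" "\<And>\<theta> i. \<theta> \<in> {0..1} \<Longrightarrow> i \<in> {1..N} \<Longrightarrow> c \<le> segment_vector N p \<theta> i"
    using segment_vector_lower_bound[OF N pos] by metis
  let ?Sub = "{S. S \<subseteq> {1..N} \<and> card S = m}"
  let ?d = "\<lambda>i. p i - uniform_vector N i"
  define K where "K = (\<Sum>S\<in>?Sub. \<Sum>i\<in>{1..N}. \<bar>?d i\<bar>)"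
  define \<Phi> where "\<Phi> = (\<lambda>R \<theta>. integral {0..R} (choose_density N j m (segment_vector N p \<theta>)))"
  have le: "\<Phi> R b - \<Phi> R a \<le> (b - a) * (- \<delta> + K * (R * exp (- (c * R))))" if R: "2 \<le> R" for R
  proof -
    have "(\<Phi> R has_field_derivative integral {0..R} (total_source N j m p \<theta>)
         + (\<Sum>S\<in>?Sub. flux N j S (segment_vector N p \<theta>) ?d R)) (at \<theta>)" for \<theta>
      unfolding \<Phi>_def total_source_def[abs_def]
      using j R by (intro DERIV_integral_choose_density) auto
    from MVT2[OF \<open>a < b\<close> this]
    obtain \<theta> where \<theta>: "a < \<theta>" "\<theta> < b"
      and eq: "\<Phi> R b - \<Phi> R a = (b - a) * (integral {0..R} (total_source N j m p \<theta>)
         + (\<Sum>S\<in>?Sub. flux N j S (segment_vector N p \<theta>) ?d R))"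
      by blast
    have "\<bar>\<Sum>S\<in>?Sub. flux N j S (segment_vector N p \<theta>) ?d R\<bar>
        \<le> (\<Sum>S\<in>?Sub. (\<Sum>i\<in>{1..N}. \<bar>?d i\<bar>) * (R * exp (- (c * R))))"
      using c \<theta> ab R by (intro order_trans[OF sum_abs] sum_mono abs_flux_le) auto
    also have "\<dots> = K * (R * exp (- (c * R)))"
      by (simp add: K_def sum_distrib_right)
    finally have "(\<Sum>S\<in>?Sub. flux N j S (segment_vector N p \<theta>) ?d R) \<le> K * (R * exp (- (c * R)))"
      by linarith
    then show ?thesis
      unfolding eq using ab \<delta>[OF \<theta> R] by (intro mult_left_mono add_mono) auto
  qed
  have lim: "((\<lambda>R. \<Phi> R \<theta>) \<longlongrightarrow> choose_expectation N j m (segment_vector N p \<theta>)) at_top" if "\<theta> \<in> {0..1}" for \<theta>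
    unfolding \<Phi>_def choose_expectation_def
    using N j p pos that
    by (intro tendsto_integral_choose_density is_prob_vector_segment) (auto intro!: segment_vector_pos)
  have "((\<lambda>R. (b - a) * (- \<delta> + K * (R * exp (- (c * R))))) \<longlongrightarrow> (b - a) * (- \<delta> + K * 0)) at_top"
    by (intro tendsto_intros tendsto_mult_exp_neg c)
  moreover have "((\<lambda>R. \<Phi> R b - \<Phi> R a) \<longlongrightarrow>
      choose_expectation N j m (segment_vector N p b) - choose_expectation N j m (segment_vector N p a)) at_top"
    using ab by (intro tendsto_diff lim) auto
  moreover have "\<forall>\<^sub>F R in at_top. \<Phi> R b - \<Phi> R a \<le> (b - a) * (- \<delta> + K * (R * exp (- (c * R))))"
    using eventually_ge_at_top[of 2] by eventually_elim (rule le)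
  ultimately have "choose_expectation N j m (segment_vector N p b) - choose_expectation N j m (segment_vector N p a)
      \<le> (b - a) * (- \<delta> + K * 0)"
    by (intro tendsto_le[OF trivial_limit_at_top_linorder])
  then show ?thesis by simp
qed

lemma choose_expectation_antimono:
  assumes N: "1 \<le> N" and j: "2 \<le> j" and p: "is_prob_vector N p" and pos: "\<forall>i\<in>{1..N}. 0 < p i"
    and ab: "0 \<le> a" "a \<le> b" "b \<le> 1"
  shows "choose_expectation N j m (segment_vector N p b) \<le> choose_expectation N j m (segment_vector N p a)"
proof (cases "a = b")
  case False
  with ab have "a < b" by simp
  have "integral {0..R} (total_source N j m p \<theta>) \<le> - 0" if "a < \<theta>" "\<theta> < b" for \<theta> R
  proof -
    have "integral {0..R} (total_source N j m p \<theta>) \<le> integral {0..R} (\<lambda>_. 0)"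
      using ab that N pos
      by (intro integral_le integrable_continuous_real continuous_on_total_source continuous_intros)
         (auto intro!: total_source_nonpos)
    then show ?thesis by simp
  qed
  from choose_expectation_increment_le[OF N j p pos ab(1) \<open>a < b\<close> ab(3) this]
  show ?thesis by simp
qed simp

text \<open>
  A strict inequality has to survive the limit in \<open>choose_expectation_increment_le\<close>, so the
  source needs a bound away from \<open>0\<close> that does not depend on \<open>R\<close>. Compactness gives one for
  times in \<open>{1..2}\<close> and parameters bounded away from \<open>0\<close>; at the parameter \<open>0\<close> the source
  vanishes. For the remaining times and parameters the sign of the source is enough.
\<close>

lemma choose_expectation_strict_antimono:
  assumes N: "1 \<le> N" and j: "2 \<le> j" and m: "1 \<le> m" "m \<le> N"
    and p: "is_prob_vector N p" and pos: "\<forall>i\<in>{1..N}. 0 < p i"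
    and ne: "x \<in> {1..N}" "y \<in> {1..N}" "p x \<noteq> p y"
  shows "strict_antimono_on {0..1} (\<lambda>\<theta>. choose_expectation N j m (segment_vector N p \<theta>))"
proof (rule monotone_onI)
  fix s b :: real
  assume sb: "s \<in> {0..1}" "b \<in> {0..1}" "s < b"
  \<comment> \<open>The midpoint is positive even if \<open>s = 0\<close>, so strict decrease on \<open>{a..b}\<close> suffices.\<close>
  define a where "a = (s + b) / 2"
  have a: "0 < a" "s \<le> a" "a < b" "b \<le> 1"
    using sb by (auto simp: a_def)
  have cont: "continuous_on ({a..b} \<times> {1..2}) (\<lambda>x. total_source N j m p (fst x) (snd x))"
    by (intro continuous_on_total_source continuous_intros)
  have comp: "compact ({a..b} \<times> {1..2::real})" "{a..b} \<times> {1..2::real} \<noteq> {}"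
    using a by (auto intro: compact_Times)
  obtain z where z: "z \<in> {a..b} \<times> {1..2}"
    and max: "\<And>x. x \<in> {a..b} \<times> {1..2} \<Longrightarrow> total_source N j m p (fst x) (snd x) \<le> total_source N j m p (fst z) (snd z)"
    using continuous_attains_sup[OF comp cont] by blast
  define \<delta> where "\<delta> = - total_source N j m p (fst z) (snd z)"
  have \<delta>: "0 < \<delta>"
    unfolding \<delta>_def using total_source_neg[OF N j m pos _ _ _ ne, of "fst z" "snd z"] z a by auto
  have "integral {0..R} (total_source N j m p \<theta>) \<le> - \<delta>" if \<theta>: "a < \<theta>" "\<theta> < b" and R: "2 \<le> R" for \<theta> R
  proof -
    have int: "total_source N j m p \<theta> integrable_on {u..v}" for u v
      by (intro integrable_continuous_real continuous_on_total_source continuous_intros)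
    have nonpos: "integral {u..v} (total_source N j m p \<theta>) \<le> 0" if "0 \<le> u" for u v
    proof -
      have "integral {u..v} (total_source N j m p \<theta>) \<le> integral {u..v} (\<lambda>_. 0)"
        using a \<theta> that by (intro integral_le int) (auto intro!: total_source_nonpos[OF N pos])
      then show ?thesis by simp
    qed
    have "integral {1..2} (total_source N j m p \<theta>) \<le> integral {1..2::real} (\<lambda>_. - \<delta>)"
      using \<theta> max[of "(\<theta>, t)" for t] by (intro integral_le int) (auto simp: \<delta>_def)
    moreover have "integral {0..R} (total_source N j m p \<theta>) =
        integral {0..1} (total_source N j m p \<theta>) + (integral {1..2} (total_source N j m p \<theta>)
        + integral {2..R} (total_source N j m p \<theta>))"
      using R by (simp add: Henstock_Kurzweil_Integration.integral_combine int)
    ultimately show ?thesis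
      using nonpos[of 0 1] nonpos[of 2 R] by simp
  qed
  from choose_expectation_increment_le[OF N j p pos less_imp_le[OF a(1)] a(3,4) this]
  have "choose_expectation N j m (segment_vector N p b) - choose_expectation N j m (segment_vector N p a) \<le> (b - a) * - \<delta>" .
  also have "\<dots> < 0"
    using a \<delta> by (simp add: mult_pos_neg)
  finally have "choose_expectation N j m (segment_vector N p b) < choose_expectation N j m (segment_vector N p a)"
    by simp
  also have "\<dots> \<le> choose_expectation N j m (segment_vector N p s)"
    using sb a by (intro choose_expectation_antimono N j p pos) auto
  finally show "choose_expectation N j m (segment_vector N p b) < choose_expectation N j m (segment_vector N p s)" .
qed

text \<open>
  The coefficients \<open>(z - 1) ^ m\<close> are positive for \<open>z > 1\<close>; the monotonicity of the binomial
  moments therefore carries over to \<open>z ^ u\<close>.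
\<close>

lemma power_eq_sum_choose:
  fixes z :: real
  assumes "u \<le> N"
  shows "z ^ u = (\<Sum>m\<le>N. (z - 1) ^ m * real (u choose m))"
proof -
  have "z ^ u = (\<Sum>m\<le>u. (z - 1) ^ m * real (u choose m))"
    using binomial_ring[of "z - 1" 1 u] by (simp add: mult.commute)
  also have "\<dots> = (\<Sum>m\<le>N. (z - 1) ^ m * real (u choose m))"
    using assms by (intro sum.mono_neutral_left) auto
  finally show ?thesis .
qed

lemma coupon_expectation_power:
  assumes "1 \<le> j"
  shows "coupon_expectation N q (\<lambda>\<omega>. z ^ empty_spaces N j \<omega>) = (\<Sum>m\<le>N. (z - 1) ^ m * choose_expectation N j m q)"
  unfolding coupon_expectation_def choose_expectation_def power_eq_sum_choose[OF empty_spaces_le]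
  by (subst Bochner_Integration.integral_sum) (auto intro!: integrable_mult_right integrable_empty_spaces[OF assms])

lemma power_expectation_strict_antimono:
  assumes N: "1 \<le> N" and j: "2 \<le> j" and z: "1 < z"
    and p: "is_prob_vector N p" and pos: "\<forall>i\<in>{1..N}. 0 < p i"
    and ne: "x \<in> {1..N}" "y \<in> {1..N}" "p x \<noteq> p y"
  shows "strict_antimono_on {0..1}
    (\<lambda>\<theta>. coupon_expectation N (segment_vector N p \<theta>) (\<lambda>\<omega>. z ^ empty_spaces N j \<omega>))"
proof (rule monotone_onI)
  fix a b :: real
  assume ab: "a \<in> {0..1}" "b \<in> {0..1}" "a < b"
  have j1: "1 \<le> j" using j by simp
  show "coupon_expectation N (segment_vector N p b) (\<lambda>\<omega>. z ^ empty_spaces N j \<omega>)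
    < coupon_expectation N (segment_vector N p a) (\<lambda>\<omega>. z ^ empty_spaces N j \<omega>)"
    unfolding coupon_expectation_power[OF j1]
  proof (rule sum_strict_mono_ex1)
    show "\<forall>m\<in>{..N}. (z - 1) ^ m * choose_expectation N j m (segment_vector N p b)
        \<le> (z - 1) ^ m * choose_expectation N j m (segment_vector N p a)"
      using z ab by (auto intro!: mult_left_mono choose_expectation_antimono[OF N j p pos])
    show "\<exists>m\<in>{..N}. (z - 1) ^ m * choose_expectation N j m (segment_vector N p b)
        < (z - 1) ^ m * choose_expectation N j m (segment_vector N p a)"
      using z ab N monotone_onD[OF choose_expectation_strict_antimono[OF N j _ _ p pos ne, of 1], of a b]
      by (intro bexI[of _ 1]) auto
  qed simp
qed

lemma nonuniform_coordinates:
  assumes "is_prob_vector N p" and i: "i \<in> {1..N}" "p i \<noteq> uniform_vector N i"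
  obtains k where "k \<in> {1..N}" "p k \<noteq> p i"
proof -
  have "\<not> (\<forall>k\<in>{1..N}. p k = p i)"
  proof
    assume "\<forall>k\<in>{1..N}. p k = p i"
    then have "(\<Sum>k=1..N. p k) = real N * p i"
      by simp
    with assms show False
      by (simp add: is_prob_vector_def uniform_vector_def field_simps)
  qed
  then show ?thesis using that by blast
qed

theorem theorem1p1:
  fixes N j :: nat and p :: "nat \<Rightarrow> real"
  assumes "N \<ge> 2" and "j \<ge> 2"
    and "is_prob_vector N p"
    and "\<forall>i\<in>{1..N}. 0 < p i"
    and "\<exists>i\<in>{1..N}. p i \<noteq> uniform_vector N i"
  shows
    "(\<forall>z::real. 1 < z \<longrightarrow>
        strict_antimono_on {0<..1}
          (\<lambda>\<theta>. coupon_expectation N (segment_vector N p \<theta>) (\<lambda>\<omega>. z ^ empty_spaces N j \<omega>)) \<and>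
        coupon_expectation N p (\<lambda>\<omega>. z ^ empty_spaces N j \<omega>)
          < coupon_expectation N (uniform_vector N) (\<lambda>\<omega>. z ^ empty_spaces N j \<omega>)) \<and>
     (\<forall>m\<in>{1..N}.
        strict_antimono_on {0<..1}
          (\<lambda>\<theta>. coupon_expectation N (segment_vector N p \<theta>)
                 (\<lambda>\<omega>. real (empty_spaces N j \<omega> choose m)))) \<and>
     (\<forall>m\<ge>1. coupon_expectation N p (\<lambda>\<omega>. real (empty_spaces N j \<omega> choose m))
        \<le> coupon_expectation N (uniform_vector N) (\<lambda>\<omega>. real (empty_spaces N j \<omega> choose m))) \<and>
     (\<forall>m\<in>{1..N}. coupon_expectation N p (\<lambda>\<omega>. real (empty_spaces N j \<omega> choose m))
        < coupon_expectation N (uniform_vector N) (\<lambda>\<omega>. real (empty_spaces N j \<omega> choose m))) \<and>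
     (\<forall>m>N. coupon_expectation N p (\<lambda>\<omega>. real (empty_spaces N j \<omega> choose m)) = 0 \<and>
        coupon_expectation N (uniform_vector N) (\<lambda>\<omega>. real (empty_spaces N j \<omega> choose m)) = 0)"
proof -
  have N: "1 \<le> N" using assms(1) by simp
  obtain x where x: "x \<in> {1..N}" "p x \<noteq> uniform_vector N x" using assms(5) by blast
  obtain y where y: "y \<in> {1..N}" "p y \<noteq> p x"
    using nonuniform_coordinates[OF assms(3) x] .
  have ends: "segment_vector N p 0 = uniform_vector N" "segment_vector N p 1 = p"
    by (auto simp: segment_vector_def)
  have pow: "strict_antimono_on {0..1}
      (\<lambda>\<theta>. coupon_expectation N (segment_vector N p \<theta>) (\<lambda>\<omega>. z ^ empty_spaces N j \<omega>))" if "1 < z" for z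
    by (rule power_expectation_strict_antimono[OF N assms(2) that assms(3,4) y(1) x(1) y(2)])
  have choose: "strict_antimono_on {0..1} (\<lambda>\<theta>. coupon_expectation N (segment_vector N p \<theta>)
      (\<lambda>\<omega>. real (empty_spaces N j \<omega> choose m)))" if "m \<in> {1..N}" for m
    using choose_expectation_strict_antimono[OF N assms(2) _ _ assms(3,4) y(1) x(1) y(2), of m] that
    unfolding choose_expectation_def by simp
  have sub: "{0<..1} \<subseteq> {0..1::real}" by auto
  have pow_ends: "coupon_expectation N p (\<lambda>\<omega>. z ^ empty_spaces N j \<omega>)
      < coupon_expectation N (uniform_vector N) (\<lambda>\<omega>. z ^ empty_spaces N j \<omega>)" if "1 < z" for z
    using monotone_onD[OF pow[OF that], of 0 1] by (simp add: ends)
  have choose_ends: "coupon_expectation N p (\<lambda>\<omega>. real (empty_spaces N j \<omega> choose m))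
      < coupon_expectation N (uniform_vector N) (\<lambda>\<omega>. real (empty_spaces N j \<omega> choose m))" if "m \<in> {1..N}" for m
    using monotone_onD[OF choose[OF that], of 0 1] by (simp add: ends)
  have zero: "coupon_expectation N q (\<lambda>\<omega>. real (empty_spaces N j \<omega> choose m)) = 0" if "N < m" for m q
    using le_less_trans[OF empty_spaces_le that] by (simp add: coupon_expectation_def binomial_eq_0)
  have "coupon_expectation N p (\<lambda>\<omega>. real (empty_spaces N j \<omega> choose m))
      \<le> coupon_expectation N (uniform_vector N) (\<lambda>\<omega>. real (empty_spaces N j \<omega> choose m))" if "1 \<le> m" for m
    using choose_ends[of m] zero[of m] that by (cases "m \<le> N") auto
  then show ?thesis
    using pow_ends choose_ends zero monotone_on_subset[OF pow sub] monotone_on_subset[OF choose sub]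
    by blast
qed

end
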